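(* Let $G$ be a connected and compact metric graph. For every edge $\mathsf e\in E(G)$ let $1<p_{\mathsf e}<\infty$ and let $\gamma_{\mathsf e}:\mathbb R\to\mathbb R$ be a continuous and strictly increasing function with $\gamma_{\mathsf e}(\mathbb R)=\mathbb R$ and $\gamma_{\mathsf e}(0)=0$. Then, for every $f\in L^1(G)$ and every family $\omega=\{\omega_{\mathsf v}:\mathsf v\in V(G)\}\subset\mathbb R$, there exists a unique weak solution $v\in L^1(G)$ of the problem $(P^f_\omega)$.
   Context: A compact metric graph $G$ has finite vertex set $V(G)$ and finite edge set $E(G)$; each edge $\mathsf e$ is identified with an ordered pair $(\mathsf i_{\mathsf e},\mathsf f_{\mathsf e})$ of vertices (initial, terminal), has a length $\ell_{\mathsf e}\in(0,\infty)$, and is parametrized by $[0,\ell_{\mathsf e}]$ with $\mathsf i_{\mathsf e}$ corresponding to $0$ and $\mathsf f_{\mathsf e}$ to $\ell_{\mathsf e}$. Standing assumption: there are no loops and no two different edges joining the same two vertices. A function $u$ on $G$ is a collection of functions $[u]_{\mathsf e}$ on $(0,\ell_{\mathsf e})$, $\mathsf e\in E(G)$; $\int_G u\,dx:=\sum_{\mathsf e\in E(G)}\int_0^{\ell_{\mathsf e}}[u]_{\mathsf e}\,dx$, and $L^1(G)$ is the set of $u$ with all $[u]_{\mathsf e}\in L^1(0,\ell_{\mathsf e})$. For $\overline p=(p_{\mathsf e})_{\mathsf e\in E(G)}$, $\mathcal W^{1,\overline p}(G)$ is the space of functions $u$ on $G$ with $[u]_{\mathsf e}\in W^{1,p_{\mathsf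 e}}(0,\ell_{\mathsf e})$ for all $\mathsf e$ (taken continuous on $[0,\ell_{\mathsf e}]$) and such that at each vertex $\mathsf v$ the values of $[u]_{\mathsf e}$ at the endpoint corresponding to $\mathsf v$ coincide for all edges $\mathsf e$ incident to $\mathsf v$; the common value is $u(\mathsf v)$. Write $v=\overline\gamma(u)$ if $[v]_{\mathsf e}=\gamma_{\mathsf e}([u]_{\mathsf e})$ for all $\mathsf e$. Problem $(P^f_\omega)$ is formally: $[v]_{\mathsf e}-(|[u]_{\mathsf e}'|^{p_{\mathsf e}-2}[u]_{\mathsf e}')'=[f]_{\mathsf e}$ on each edge, $v=\overline\gamma(u)$, $u$ continuous on $G$, with total outward flux $\omega_{\mathsf v}$ at each vertex. A function $v\in L^1(G)$ is a weak solution of $(P^f_\omega)$ if there is $u\in\mathcal W^{1,\overline p}(G)$ with $v=\overline\gamma(u)$ a.e. in $G$ such that for all $\varphi\in\mathcal W^{1,\overline p}(G)$ $$\int_G v\varphi\,dx+\sum_{\mathsf e\in E(G)}\int_0^{\ell_{\mathsf e}}|[u]_{\mathsf e}'|^{p_{\mathsf e}-2}[u]_{\mathsf e}'[\varphi]_{\mathsf e}'\,dx=\int_G f\varphi\,dx+\sum_{\mathsf v\in V(G)}\omega_{\mathsf v}\varphi(\mathsf v).$$ *)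

theory Defs
  imports "HOL-Analysis.Analysis" "Graph_Theory.Digraph_Component"
begin

section \<open>Sobolev spaces on a bounded open interval\<close>

definition Lp_on :: "real \<Rightarrow> real \<Rightarrow> real \<Rightarrow> (real \<Rightarrow> real) \<Rightarrow> bool" where
  "Lp_on p a b u \<longleftrightarrow>
     u \<in> borel_measurable (lebesgue_on {a<..<b}) \<and>
     integrable (lebesgue_on {a<..<b}) (\<lambda>x. \<bar>u x\<bar> powr p)"

definition locally_integrable_on :: "real \<Rightarrow> real \<Rightarrow> (real \<Rightarrow> real) \<Rightarrow> bool" where
  "locally_integrable_on a b u \<longleftrightarrow>
     (\<forall>K. compact K \<and> K \<subseteq> {a<..<b} \<longrightarrow> integrable (lebesgue_on K) u)"

text \<open>The space $C^1_c(a,b)$; its elements are extended by zero to the real line.\<close>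

definition test_function :: "real \<Rightarrow> real \<Rightarrow> (real \<Rightarrow> real) \<Rightarrow> bool" where
  "test_function a b \<psi> \<longleftrightarrow>
     (\<forall>x. \<psi> differentiable (at x)) \<and> continuous_on UNIV (deriv \<psi>) \<and>
     (\<exists>K. compact K \<and> K \<subseteq> {a<..<b} \<and> (\<forall>x. x \<notin> K \<longrightarrow> \<psi> x = 0))"

definition is_weak_deriv :: "real \<Rightarrow> real \<Rightarrow> (real \<Rightarrow> real) \<Rightarrow> (real \<Rightarrow> real) \<Rightarrow> bool" where
  "is_weak_deriv a b u g \<longleftrightarrow>
     locally_integrable_on a b u \<and> locally_integrable_on a b g \<and>
     (\<forall>\<psi>. test_function a b \<psi> \<longrightarrow>
        (LINT x|lebesgue_on {a<..<b}. u x * deriv \<psi> x) =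
        - (LINT x|lebesgue_on {a<..<b}. g x * \<psi> x))"

text \<open>A representative of the weak derivative, which is determined up to a null set.\<close>

definition weak_deriv :: "real \<Rightarrow> real \<Rightarrow> (real \<Rightarrow> real) \<Rightarrow> real \<Rightarrow> real" where
  "weak_deriv a b u = (SOME g. is_weak_deriv a b u g)"

definition W1p_on :: "real \<Rightarrow> real \<Rightarrow> real \<Rightarrow> (real \<Rightarrow> real) \<Rightarrow> bool" where
  "W1p_on p a b u \<longleftrightarrow> Lp_on p a b u \<and> (\<exists>g. is_weak_deriv a b u g \<and> Lp_on p a b g)"


section \<open>Compact metric graphs\<close>

text \<open>
  An edge is the pair of its initial and terminal vertex. The locale \<open>pair_digraph\<close> provides
  finiteness and absence of loops; \<open>no_antiparallel\<close> excludes the remaining way in which two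
  different edges could join the same two vertices.
\<close>

locale compact_metric_graph = pair_digraph G
  for G :: "'v pair_pre_digraph" +
  fixes len :: "'v \<times> 'v \<Rightarrow> real"
  assumes len_pos: "e \<in> parcs G \<Longrightarrow> 0 < len e"
    and no_antiparallel: "(a, b) \<in> parcs G \<Longrightarrow> (b, a) \<notin> parcs G"

text \<open>Connectedness as a graph: the orientation of the edges is disregarded.\<close>

abbreviation connected_graph :: "'v pair_pre_digraph \<Rightarrow> bool" where
  "connected_graph G \<equiv> Digraph_Component.connected (with_proj G)"

text \<open>
  The component \<open>u e\<close> of a function on the graph is only relevant on the interval from \<open>0\<close> to
  \<open>len e\<close>, and only for edges \<open>e\<close> of the graph.
\<close>

type_synonym 'v graph_fun = "'v \<times> 'v \<Rightarrow> real \<Rightarrow> real"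

definition graph_integral ::
  "'v pair_pre_digraph \<Rightarrow> ('v \<times> 'v \<Rightarrow> real) \<Rightarrow> 'v graph_fun \<Rightarrow> real" where
  "graph_integral G len u = (\<Sum>e\<in>parcs G. LINT x|lebesgue_on {0<..<len e}. u e x)"

definition L1_graph ::
  "'v pair_pre_digraph \<Rightarrow> ('v \<times> 'v \<Rightarrow> real) \<Rightarrow> 'v graph_fun \<Rightarrow> bool" where
  "L1_graph G len u \<longleftrightarrow> (\<forall>e\<in>parcs G. integrable (lebesgue_on {0<..<len e}) (u e))"

definition ae_eq_graph ::
  "'v pair_pre_digraph \<Rightarrow> ('v \<times> 'v \<Rightarrow> real) \<Rightarrow> 'v graph_fun \<Rightarrow> 'v graph_fun \<Rightarrow> bool" where
  "ae_eq_graph G len u w \<longleftrightarrow>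
     (\<forall>e\<in>parcs G. AE x in lebesgue_on {0<..<len e}. u e x = w e x)"

definition incident_edges :: "'v pair_pre_digraph \<Rightarrow> 'v \<Rightarrow> ('v \<times> 'v) set" where
  "incident_edges G z = {e \<in> parcs G. fst e = z \<or> snd e = z}"

definition end_value :: "('v \<times> 'v \<Rightarrow> real) \<Rightarrow> 'v graph_fun \<Rightarrow> 'v \<times> 'v \<Rightarrow> 'v \<Rightarrow> real" where
  "end_value len u e z = (if z = fst e then u e 0 else u e (len e))"

definition W1p_graph ::
  "'v pair_pre_digraph \<Rightarrow> ('v \<times> 'v \<Rightarrow> real) \<Rightarrow> ('v \<times> 'v \<Rightarrow> real) \<Rightarrow> 'v graph_fun \<Rightarrow> bool" where
  "W1p_graph G len p u \<longleftrightarrow>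
     (\<forall>e\<in>parcs G. W1p_on (p e) 0 (len e) (u e) \<and> continuous_on {0..len e} (u e)) \<and>
     (\<forall>z\<in>pverts G. \<forall>e\<in>incident_edges G z. \<forall>e'\<in>incident_edges G z.
        end_value len u e z = end_value len u e' z)"

text \<open>
  The common value at a vertex. A function on the graph carries no value at a vertex without
  incident edges, where we put \<open>0\<close>; in a connected graph this convention is only used for the
  degenerate graph consisting of one vertex and no edge.
\<close>

definition vertex_value ::
  "'v pair_pre_digraph \<Rightarrow> ('v \<times> 'v \<Rightarrow> real) \<Rightarrow> 'v graph_fun \<Rightarrow> 'v \<Rightarrow> real" where
  "vertex_value G len u z =
     (if incident_edges G z = {} then 0
      else (THE c. \<forall>e\<in>incident_edges G z. end_value len u e z = c))"


section \<open>Weak solutions\<close>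

definition weak_solution ::
  "'v pair_pre_digraph \<Rightarrow> ('v \<times> 'v \<Rightarrow> real) \<Rightarrow> ('v \<times> 'v \<Rightarrow> real) \<Rightarrow> ('v \<times> 'v \<Rightarrow> real \<Rightarrow> real) \<Rightarrow>
   'v graph_fun \<Rightarrow> ('v \<Rightarrow> real) \<Rightarrow> 'v graph_fun \<Rightarrow> bool" where
  "weak_solution G len p \<gamma> f \<omega> v \<longleftrightarrow>
     L1_graph G len v \<and>
     (\<exists>u. W1p_graph G len p u \<and>
        ae_eq_graph G len v (\<lambda>e x. \<gamma> e (u e x)) \<and>
        (\<forall>\<phi>. W1p_graph G len p \<phi> \<longrightarrow>
           graph_integral G len (\<lambda>e x. v e x * \<phi> e x) +
           (\<Sum>e\<in>parcs G. LINT x|lebesgue_on {0<..<len e}.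
              \<bar>weak_deriv 0 (len e) (u e) x\<bar> powr (p e - 2) * weak_deriv 0 (len e) (u e) x *
              weak_deriv 0 (len e) (\<phi> e) x) =
           graph_integral G len (\<lambda>e x. f e x * \<phi> e x) +
           (\<Sum>z\<in>pverts G. \<omega> z * vertex_value G len \<phi> z)))"

end

theory Submission
  imports Defs
begin

text \<open>
  Weak solutions are the functions \<open>\<gamma>\<^sub>e(u\<^sub>e)\<close> for critical points \<open>u\<close> of the strictly convex functional
  \<open>J(u) = \<Sum>\<^sub>e (\<integral> |u'|\<^sup>p / p + \<integral> \<Gamma>\<^sub>e(u) - \<integral> f u) - \<Sum>\<^sub>v \<omega>\<^sub>v u(v)\<close>, where \<open>\<Gamma>\<^sub>e' = \<gamma>\<^sub>e\<close>. As \<open>\<gamma>\<^sub>e\<close> is onto,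
  \<open>\<Gamma>\<^sub>e\<close> is superlinear, so sublevels of \<open>J\<close> bound \<open>u\<close> uniformly and \<open>u'\<close> in \<open>L\<^sup>p\<close>. No weak
  compactness is needed: by convexity the midpoint gaps
  \<open>(|a|\<^sup>p + |b|\<^sup>p) / 2 - |(a + b) / 2|\<^sup>p\<close> of the derivatives along a minimizing sequence have integrals
  tending to \<open>0\<close>, which makes the derivatives Cauchy in \<open>L\<^sup>1\<close>; Fatou's lemma then shows that the
  limit is a minimizer. Convexity also bounds the difference quotients of \<open>J\<close>, which gives the
  Euler-Lagrange identity by dominated convergence, and monotonicity gives uniqueness.
\<close>

section \<open>Convexity of powers\<close>

text \<open>Two obstacles shape the proof. First, \<open>weak_deriv\<close> picks a representative,
  and the choice made for a sum need not be the sum of the choices. Functions therefore travel as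
  pairs (u, g) in which u is a primitive of the L^p function g. Pairs can be added and scaled
  literally, and g is exchanged for \<open>weak_deriv\<close>, which alters it on a null set only,
  when the weak formulation is reached. Second, the linear terms given by f and \<omega> are
  controlled by the maximum of |u| on the edges, while the coercive terms are integrals. The
  oscillation of u is at most the L^1 norm of u', so the integral of \<Gamma>(u), which dominates
  any multiple of |u| up to a constant, pays for the maximum up to this norm, and half of the
  p-energy pays for the norm. Bolzano-Weierstrass is then applied to finitely many real sequences
  only, one end value and one p-energy per edge; the L^1 estimate for the derivatives does the rest.
  In the limit the p-energy alone may drop, which is the favourable direction.\<close>

definition p_flux :: "real \<Rightarrow> real \<Rightarrow> real" where
  "p_flux p s = \<bar>s\<bar> powr (p - 2) * s"

lemma p_flux_pos: "0 \<le> s \<Longrightarrow> p_flux p s = s powr (p - 1)"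
  by (cases "s = 0") (auto simp: p_flux_def powr_diff power2_eq_square powr_numeral)

lemma p_flux_minus: "p_flux p (- s) = - p_flux p s"
  by (simp add: p_flux_def)

lemma abs_p_flux: "\<bar>p_flux p s\<bar> = \<bar>s\<bar> powr (p - 1)"
  using p_flux_pos[of "\<bar>s\<bar>" p] by (simp add: p_flux_def abs_mult)

lemma p_flux_mult_self: "p_flux p s * s = \<bar>s\<bar> powr p"
  by (cases "s = 0") (auto simp: p_flux_def powr_diff powr_numeral power2_eq_square abs_mult_self_eq)

text \<open>For \<open>p < 2\<close> the factor \<open>\<bar>s\<bar> powr (p - 2)\<close> is
  unbounded near 0. Rewriting the flux as a difference of two powers with the positive exponent
  \<open>p - 1\<close> gives terms that are continuous across 0.\<close>

lemma continuous_p_flux: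
  assumes "1 < p"
  shows "continuous_on UNIV (p_flux p)"
proof -
  have "p_flux p = (\<lambda>s. max s 0 powr (p - 1) - max (- s) 0 powr (p - 1))"
  proof
    fix s show "p_flux p s = max s 0 powr (p - 1) - max (- s) 0 powr (p - 1)"
      using p_flux_pos[of s p] p_flux_pos[of "- s" p] p_flux_minus[of p s]
      by (cases "0 \<le> s") (auto simp: max_def)
  qed
  moreover have "continuous_on UNIV (\<lambda>s. max s 0 powr (p - 1) - max (- s) 0 powr (p - 1))"
    using assms by (intro continuous_intros continuous_on_powr') auto
  ultimately show ?thesis by simp
qed

lemma strict_mono_p_flux:
  assumes "1 < p"
  shows "strict_mono (p_flux p)"
proof (rule strict_monoI)
  fix a b :: real assume ab: "a < b"
  have pos: "p_flux p s < p_flux p t" if "0 \<le> s" "s < t" for s t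
    using that assms by (simp add: p_flux_pos powr_less_mono2)
  have sgn: "0 \<le> p_flux p s" if "0 \<le> s" for s
    using that by (simp add: p_flux_pos)
  show "p_flux p a < p_flux p b"
  proof (cases "0 \<le> a")
    case True then show ?thesis using pos ab by simp
  next
    case False
    show ?thesis
    proof (cases "0 \<le> b")
      case True
      have "p_flux p 0 < p_flux p (- a)" using pos[of 0 "- a"] False by simp
      then show ?thesis using sgn[OF True] by (simp add: p_flux_minus p_flux_pos)
    next
      case b: False
      then show ?thesis using pos[of "- b" "- a"] ab by (simp add: p_flux_minus)
    qed
  qed
qed

text \<open>Young's inequality with the conjugate exponent p/(p-1). Its sharp constants yield the
  tangent inequality \<open>powr_subgradient\<close>; it also supplies the integrable bound for a
  flux multiplied by a test derivative.\<close>

lemma p_flux_mult_le: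
  assumes "1 < p"
  shows "\<bar>p_flux p a * b\<bar> \<le> (1 - 1/p) * \<bar>a\<bar> powr p + \<bar>b\<bar> powr p / p"
proof -
  define q where "q = p / (p - 1)"
  have q: "1 < q" "1 / q + 1 / p = 1" "(p - 1) * q = p" "1 / q = 1 - 1 / p"
    using assms by (auto simp: q_def field_simps)
  have "(\<bar>a\<bar> powr (p - 1)) * \<bar>b\<bar> \<le> (\<bar>a\<bar> powr (p - 1)) powr q / q + \<bar>b\<bar> powr p / p"
    by (rule Youngs_inequality) (use assms q in auto)
  also have "(\<bar>a\<bar> powr (p - 1)) powr q / q = (1 - 1/p) * \<bar>a\<bar> powr p"
    using q by (metis powr_powr times_divide_eq_left mult_1 mult.commute)
  finally show ?thesis by (simp add: abs_mult abs_p_flux)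
qed

text \<open>The tangent inequality for |s|^p / p, whose derivative is \<open>p_flux p\<close>. No
  differentiation is involved: \<open>p_flux p b * b\<close> is |b|^p, and subtracting Young's share
  (1 - 1/p) |b|^p leaves exactly |b|^p / p.\<close>

lemma powr_subgradient:
  assumes "1 < p"
  shows "\<bar>b\<bar> powr p / p - \<bar>a\<bar> powr p / p \<le> p_flux p b * (b - a)"
proof -
  have "p_flux p b * a \<le> (1 - 1/p) * \<bar>b\<bar> powr p + \<bar>a\<bar> powr p / p"
    using p_flux_mult_le[OF assms, of b a] by linarith
  then show ?thesis
    using p_flux_mult_self[of p b] by (simp add: algebra_simps)
qed

lemma powr_abs_le_sum:
  fixes a b p :: real
  assumes "0 < p"
  shows "\<bar>a + b\<bar> powr p \<le> 2 powr p * (\<bar>a\<bar> powr p + \<bar>b\<bar> powr p)"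
proof -
  have "\<bar>a + b\<bar> powr p \<le> (2 * max \<bar>a\<bar> \<bar>b\<bar>) powr p"
    using assms by (intro powr_mono2) auto
  also have "\<dots> = 2 powr p * max \<bar>a\<bar> \<bar>b\<bar> powr p"
    by (simp add: powr_mult)
  also have "max \<bar>a\<bar> \<bar>b\<bar> powr p \<le> \<bar>a\<bar> powr p + \<bar>b\<bar> powr p"
    by (auto simp: max_def)
  finally show ?thesis by simp
qed

lemma powr_superlinear:
  fixes p K :: real
  assumes "1 < p"
  obtains C where "0 \<le> C" "\<And>s. 0 \<le> s \<Longrightarrow> K * s \<le> s powr p + C"
proof
  \<comment> \<open>The threshold at which s^(p-1) overtakes K: beyond it the power wins, and below
    it the left side is at most \<open>max K 0 * R\<close>.\<close>
  define R where "R = (max K 0) powr (1 / (p - 1))"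
  have R: "0 \<le> R" "R powr (p - 1) = max K 0" using assms by (auto simp: R_def powr_powr)
  show "0 \<le> max K 0 * R" using R by simp
  fix s :: real assume s: "0 \<le> s"
  show "K * s \<le> s powr p + max K 0 * R"
  proof (cases "s \<le> R")
    case True
    then have "K * s \<le> max K 0 * R" using s by (intro mult_mono) auto
    then show ?thesis using powr_ge_zero[of s p] by linarith
  next
    case False
    then have "R powr (p - 1) \<le> s powr (p - 1)" using R assms by (intro powr_mono2) auto
    then have "K * s \<le> s powr (p - 1) * s" using R s by (intro mult_right_mono) auto
    also have "\<dots> = s powr p" using False R
      by (simp add: powr_diff)
    finally show ?thesis using R by (smt (verit) mult_nonneg_nonneg)
  qed
qed

text \<open>With m the midpoint, the two bounds \<open>A m * (m - a)\<close> and
  \<open>A m * (m - b)\<close> cancel.\<close>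

lemma subgradient_midpoint:
  fixes P A :: "real \<Rightarrow> real"
  assumes "\<And>a b. P b - P a \<le> A b * (b - a)"
  shows "P ((a + b) / 2) \<le> (P a + P b) / 2"
  using assms[of "(a + b) / 2" a] assms[of "(a + b) / 2" b]
  by (simp add: field_simps)

text \<open>The inequalities at m alone give only the weak estimate. Passing from m to a through the
  extra point k halfway between them leaves the remainder \<open>- ((A k - A m) * (k - m))\<close>,
  which strict monotonicity of A makes negative.\<close>

lemma subgradient_midpoint_strict:
  fixes P A :: "real \<Rightarrow> real"
  assumes sub: "\<And>a b. P b - P a \<le> A b * (b - a)" and A: "strict_mono A" and ab: "a \<noteq> b"
  shows "P ((a + b) / 2) < (P a + P b) / 2"
proof -
  define m where "m = (a + b) / 2"
  define k where "k = (a + m) / 2"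
  have d: "a - k = k - m" "2 * (k - m) = m - b" "m \<noteq> k" using ab by (auto simp: m_def k_def field_simps)
  have "0 < (A k - A m) * (k - m)"
    using A d(3) by (cases "k < m") (auto simp: strict_mono_def mult_neg_neg intro!: mult_pos_pos)
  moreover have "P m - P b \<le> A m * (m - b)" "P m - P k \<le> A m * (m - k)" "P k - P a \<le> A k * (k - a)"
    by (rule sub)+
  moreover have "A m * (m - b) + A m * (m - k) + A k * (k - a) = - ((A k - A m) * (k - m))"
    using d by (simp add: algebra_simps) algebra
  ultimately have "2 * P m < P a + P b" by linarith
  then show ?thesis by (simp add: m_def)
qed

section \<open>Midpoint gaps as a measure of strict convexity\<close>

definition midpoint_gap :: "real \<Rightarrow> real \<Rightarrow> real \<Rightarrow> real" where
  "midpoint_gap p a b =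
     (\<bar>a\<bar> powr p / p + \<bar>b\<bar> powr p / p) / 2 - \<bar>(a + b) / 2\<bar> powr p / p"

lemma midpoint_gap_nonneg: "1 < p \<Longrightarrow> 0 \<le> midpoint_gap p a b"
  using subgradient_midpoint[of "\<lambda>s. \<bar>s\<bar> powr p / p" "p_flux p" a b] powr_subgradient[of p]
  by (simp add: midpoint_gap_def)

lemma midpoint_gap_pos: "1 < p \<Longrightarrow> a \<noteq> b \<Longrightarrow> 0 < midpoint_gap p a b"
  using subgradient_midpoint_strict[of "\<lambda>s. \<bar>s\<bar> powr p / p" "p_flux p" a b] powr_subgradient[of p]
  by (simp add: midpoint_gap_def strict_mono_p_flux)

text \<open>A qualitative substitute for uniform convexity of the \<open>L\<^sup>p\<close> norm: only compactness and
  strict convexity enter, so no case distinction in \<open>p\<close> is needed.\<close>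

lemma dist_le_midpoint_gap:
  fixes p \<epsilon> :: real
  assumes p: "1 < p" and \<epsilon>: "0 < \<epsilon>"
  obtains C where "0 \<le> C"
    "\<And>a b. \<bar>a - b\<bar> \<le> \<epsilon> * (1 + \<bar>a\<bar> powr p + \<bar>b\<bar> powr p) + C * midpoint_gap p a b"
proof -
  \<comment> \<open>The factor 3 leaves room for three copies of |s|: if |s| exceeds R, then 3 |s|
    is at most \<epsilon> |s|^p + R, hence 2 |s| is at most \<epsilon> |s|^p, and 2 |s| bounds |a -
    b| when |s| is the larger of the two moduli.\<close>
  obtain C0 where C0: "0 \<le> C0" "\<And>s. 0 \<le> s \<Longrightarrow> (3 / \<epsilon>) * s \<le> s powr p + C0"
    using powr_superlinear[OF p] by metis
  define R where "R = \<epsilon> * C0"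
  \<comment> \<open>The pairs that remain once large values and differences below \<epsilon> are
    paid for by the first term. On this compact set the gap is continuous and positive, so it has a
    positive lower bound c.\<close>
  define B where "B = cball 0 R \<times> cball 0 R \<inter> {z. \<epsilon> \<le> \<bar>fst z - snd z\<bar>}"
  have cB: "compact B" unfolding B_def
    by (intro compact_Int_closed compact_Times compact_cball closed_Collect_le continuous_intros)
  have cont: "continuous_on B (\<lambda>z. midpoint_gap p (fst z) (snd z))"
    unfolding midpoint_gap_def using p by (intro continuous_intros continuous_on_powr') auto
  have "\<exists>c>0. \<forall>z\<in>B. c \<le> midpoint_gap p (fst z) (snd z)"
  proof (cases "B = {}")
    case False
    then obtain z where z: "z \<in> B" "\<forall>y\<in>B. midpoint_gap p (fst z) (snd z) \<le> midpoint_gap p (fst y) (snd y)"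
      using continuous_attains_inf[OF cB _ cont] by blast
    then have "fst z \<noteq> snd z" using \<epsilon> by (auto simp: B_def)
    then show ?thesis using z midpoint_gap_pos[OF p] by blast
  qed (auto intro: exI[of _ 1])
  then obtain c where c: "0 < c" "\<And>z. z \<in> B \<Longrightarrow> c \<le> midpoint_gap p (fst z) (snd z)" by blast
  have R: "0 \<le> R" using C0 \<epsilon> by (simp add: R_def)
  show ?thesis
  proof
    \<comment> \<open>On \<open>B\<close> the distance |a - b| is at most 2 R and the gap is at
      least c, which fixes the constant.\<close>
    show "0 \<le> 2 * R / c" using R c by simp
    fix a b :: real
    note g0 = midpoint_gap_nonneg[OF p, of a b]
    have g: "0 \<le> 2 * R / c * midpoint_gap p a b" using R c g0 by (intro mult_nonneg_nonneg) auto
    have e: "0 \<le> \<epsilon> * \<bar>a\<bar> powr p" "0 \<le> \<epsilon> * \<bar>b\<bar> powr p" using \<epsilon> by auto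
    have split: "\<epsilon> * (1 + \<bar>a\<bar> powr p + \<bar>b\<bar> powr p) = \<epsilon> + \<epsilon> * \<bar>a\<bar> powr p + \<epsilon> * \<bar>b\<bar> powr p"
      by (simp add: algebra_simps)
    have big: "\<bar>s\<bar> + \<bar>t\<bar> \<le> \<epsilon> * \<bar>s\<bar> powr p" if "R < \<bar>s\<bar>" "\<bar>t\<bar> \<le> \<bar>s\<bar>" for s t
    proof -
      have "(3 / \<epsilon>) * \<bar>s\<bar> \<le> \<bar>s\<bar> powr p + C0" using C0 by simp
      then have "3 * \<bar>s\<bar> \<le> \<epsilon> * \<bar>s\<bar> powr p + R" using \<epsilon> by (simp add: field_simps R_def)
      then show ?thesis using that by linarith
    qed
    consider "R < \<bar>a\<bar>" "\<bar>b\<bar> \<le> \<bar>a\<bar>" | "R < \<bar>b\<bar>" "\<bar>a\<bar> \<le> \<bar>b\<bar>"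
      | "\<bar>a\<bar> \<le> R" "\<bar>b\<bar> \<le> R" by linarith
    then show "\<bar>a - b\<bar> \<le> \<epsilon> * (1 + \<bar>a\<bar> powr p + \<bar>b\<bar> powr p) + 2 * R / c * midpoint_gap p a b"
    proof cases
      case 1 then show ?thesis using big[of a b] g e \<epsilon> unfolding split by linarith
    next
      case 2 then show ?thesis using big[of b a] g e \<epsilon> unfolding split by linarith
    next
      case 3
      show ?thesis
      proof (cases "\<bar>a - b\<bar> < \<epsilon>")
        case True then show ?thesis using g e \<epsilon> unfolding split by linarith
      next
        case False
        then have "(a, b) \<in> B" using 3 by (auto simp: B_def)
        then have "c \<le> midpoint_gap p a b" using c by force
        then have "2 * R / c * c \<le> 2 * R / c * midpoint_gap p a b"
          using R c by (intro mult_left_mono) auto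
        then have "2 * R \<le> 2 * R / c * midpoint_gap p a b" using c by simp
        then show ?thesis using 3 e \<epsilon> unfolding split by linarith
      qed
    qed
  qed
qed

section \<open>Primitives of integrable functions\<close>

text \<open>The bridge between two calculi: the Sobolev definitions use the Bochner integral on the
  open interval, whereas primitives and the fundamental theorem of calculus are handled by the gauge
  integral on the closed one. The end points form a null set.\<close>

lemma integrable_lebesgue_on_Ioo_iff:
  fixes g :: "real \<Rightarrow> real"
  shows "integrable (lebesgue_on {a<..<b}) g \<longleftrightarrow> g absolutely_integrable_on {a..b}"
  unfolding absolutely_integrable_on_Icc_iff_Ioo
  by (simp add: set_integrable_def integrable_restrict_space)

lemma integral_lebesgue_on_Ioo:
  fixes g :: "real \<Rightarrow> real"
  assumes "g absolutely_integrable_on {a..b}"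
  shows "(LINT x|lebesgue_on {a<..<b}. g x) = integral {a..b} g"
  using has_integral_integral_lebesgue_on[of "{a<..<b}" g] assms
  by (simp add: integrable_lebesgue_on_Ioo_iff has_integral_Icc_iff_Ioo[symmetric] integral_unique)

lemma absolutely_integrable_continuous_mult:
  fixes g h :: "real \<Rightarrow> real"
  assumes "g absolutely_integrable_on {a..b}" "continuous_on {a..b} h"
  shows "(\<lambda>x. g x * h x) absolutely_integrable_on {a..b}"
proof -
  have "(\<lambda>x. h x * g x) absolutely_integrable_on {a..b}"
    using assms by (intro absolutely_integrable_bounded_measurable_product_real)
      (auto intro: continuous_imp_measurable_on_sets_lebesgue compact_imp_bounded compact_continuous_image)
  then show ?thesis by (simp add: mult.commute)
qed

text \<open>A Borel representative, extended by zero. Fubini on \<open>lborel\<close> and the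
  generation of Borel sets by half-lines both work with Borel functions, while g is only Lebesgue
  measurable; the last clause transports integrals back to g.\<close>

lemma absolutely_integrable_Icc_borel:
  fixes g :: "real \<Rightarrow> real"
  assumes g: "g absolutely_integrable_on {a..b}"
  obtains G where "integrable lborel G" "\<And>x. x \<notin> {a..b} \<Longrightarrow> G x = 0"
    "AE x in lebesgue. x \<in> {a..b} \<longrightarrow> G x = g x"
    "\<And>S. S \<in> sets borel \<Longrightarrow> (LINT x:S|lborel. G x) = integral (S \<inter> {a..b}) g"
proof -
  define h where "h = (\<lambda>x. indicator {a..b} x * g x)"
  have h: "integrable lebesgue h" using g by (simp add: set_integrable_def h_def)
  then have "h \<in> borel_measurable (completion lborel)" by (rule borel_measurable_integrable)
  then obtain G0 where G0: "G0 \<in> borel_measurable lborel" "AE x in lborel. h x = G0 x"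
    using completion_ex_borel_measurable_real by blast
  define G where "G = (\<lambda>x. indicator {a..b} x * G0 x)"
  have Gm[measurable]: "G \<in> borel_measurable borel" using G0(1) by (simp add: G_def)
  have ae: "AE x in lborel. G x = h x"
    using G0(2)
  proof eventually_elim
    case (elim x)
    then show ?case by (cases "x \<in> {a..b}") (simp_all add: G_def h_def)
  qed
  have aeL: "AE x in lebesgue. G x = h x" by (rule AE_completion[OF ae])
  have "integrable lebesgue G"
  proof (rule integrable_cong_AE_imp[OF h])
    show "G \<in> borel_measurable lebesgue" by (intro measurable_completion) simp
    show "AE x in lebesgue. h x = G x" using aeL by eventually_elim simp
  qed
  then have Gi: "integrable lborel G" by (simp add: integrable_completion)
  show ?thesis
  proof
    show "integrable lborel G" by fact
    show "G x = 0" if "x \<notin> {a..b}" for x using that by (simp add: G_def)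
    show "AE x in lebesgue. x \<in> {a..b} \<longrightarrow> G x = g x"
      using aeL by eventually_elim (auto simp: h_def)
    show "(LINT x:S|lborel. G x) = integral (S \<inter> {a..b}) g" if S: "S \<in> sets borel" for S
    proof -
      have "set_integrable lborel S G" unfolding set_integrable_def
        using Gi S by (intro integrable_mult_indicator) auto
      then have "(LINT x:S|lborel. G x) = integral S G" by (rule set_borel_integral_eq_integral(2))
      also have "\<dots> = integral S (\<lambda>x. if x \<in> {a..b} then g x else 0)"
      proof -
        obtain N where "N \<in> null_sets lebesgue" "{x. G x \<noteq> h x} \<subseteq> N"
          using aeL unfolding eventually_ae_filter by auto
        then have "negligible {x. G x \<noteq> h x}"
          using negligible_iff_null_sets negligible_subset by blast
        then show ?thesis
          by (rule integral_spike) (auto simp: h_def indicator_def split: if_splits)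
      qed
      also have "\<dots> = integral (S \<inter> {a..b}) g"
        by (simp only: integral_restrict_Int Int_commute)
      finally show ?thesis .
    qed
  qed
qed

text \<open>Integration by parts as Fubini on the triangle y \<le> x: integrating \<open>F\<close>
  in y produces the primitive of g up to x, integrating it in x produces the tail integral of h from
  y.\<close>

lemma integral_primitive_mult:
  fixes g h :: "real \<Rightarrow> real"
  assumes g: "g absolutely_integrable_on {a..b}" and h: "continuous_on {a..b} h"
  shows "integral {a..b} (\<lambda>x. integral {a..x} g * h x) = integral {a..b} (\<lambda>y. g y * integral {y..b} h)"
proof -
  obtain G where G: "integrable lborel G" "\<And>x. x \<notin> {a..b} \<Longrightarrow> G x = 0"
    "\<And>S. S \<in> sets borel \<Longrightarrow> (LINT x:S|lborel. G x) = integral (S \<inter> {a..b}) g"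
    and G_g: "AE x in lebesgue. x \<in> {a..b} \<longrightarrow> G x = g x"
    using absolutely_integrable_Icc_borel[OF g] by metis
  have hi: "h absolutely_integrable_on {a..b}" using h by (rule absolutely_integrable_continuous_real)
  define H where "H = (\<lambda>x. indicator {a..b} x * h x)"
  have Hi: "integrable lborel H"
    using borel_integrable_compact[OF _ h] by (simp add: H_def set_integrable_def)
  have HS: "(LINT x:S|lborel. H x) = integral (S \<inter> {a..b}) h" if S: "S \<in> sets borel" for S
  proof -
    have "set_integrable lborel S H" unfolding set_integrable_def
      using Hi S by (intro integrable_mult_indicator) auto
    then have "(LINT x:S|lborel. H x) = integral S H" by (rule set_borel_integral_eq_integral(2))
    also have "\<dots> = integral S (\<lambda>x. if x \<in> {a..b} then h x else 0)"
      by (intro arg_cong[where f = "integral S"]) (auto simp: H_def indicator_def)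
    also have "\<dots> = integral (S \<inter> {a..b}) h"
      by (simp only: integral_restrict_Int Int_commute)
    finally show ?thesis .
  qed
  note [measurable] = borel_measurable_integrable[OF G(1)] borel_measurable_integrable[OF Hi]
  define F where "F = (\<lambda>x y. indicator {y..} x * (G y * H x))"
  have GH: "integrable (lborel \<Otimes>\<^sub>M lborel) (\<lambda>(x, y). G y * H x)"
  proof (rule lborel_pair.Fubini_integrable)
    show "integrable lborel (\<lambda>x. LINT y|lborel. norm (case (x, y) of (x, y) \<Rightarrow> G y * H x))"
      using Hi by (simp add: abs_mult)
    show "AE x in lborel. integrable lborel (\<lambda>y. case (x, y) of (x, y) \<Rightarrow> G y * H x)"
      using G(1) by simp
  qed measurable
  have Fi: "integrable (lborel \<Otimes>\<^sub>M lborel) (case_prod F)"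
  proof (rule Bochner_Integration.integrable_bound[OF GH])
    have "(\<lambda>(x::real, y). F x y) = (\<lambda>(x, y). (if y \<le> x then 1 else 0) * (G y * H x))"
      by (auto simp: F_def fun_eq_iff)
    then show "case_prod F \<in> borel_measurable (lborel \<Otimes>\<^sub>M lborel)" by simp
    show "AE x in lborel \<Otimes>\<^sub>M lborel. norm (case x of (x, y) \<Rightarrow> F x y)
            \<le> norm (case x of (x, y) \<Rightarrow> G y * H x)"
      by (auto simp: F_def indicator_def)
  qed
  have "integral {a..b} (\<lambda>x. integral {a..x} g * h x) = (LINT x|lborel. LINT y|lborel. F x y)"
  proof -
    have "(LINT y|lborel. F x y) = indicator {a..b} x *\<^sub>R (integral {a..x} g * h x)" for x
    proof (cases "x \<in> {a..b}")
      case True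
      have "(LINT y|lborel. F x y) = (LINT y:{..x}|lborel. G y) * H x"
        unfolding set_lebesgue_integral_def integral_mult_left_zero[symmetric]
        by (intro Bochner_Integration.integral_cong) (auto simp: F_def indicator_def)
      also have "{..x} \<inter> {a..b} = {a..x}" using True by auto
      then have "(LINT y:{..x}|lborel. G y) = integral {a..x} g"
        using G(3)[of "{..x}"] by (simp only: borel_closed closed_atMost)
      finally show ?thesis using True by (simp add: H_def)
    qed (simp add: F_def H_def)
    moreover have si: "set_integrable lborel {a..b} (\<lambda>x. integral {a..x} g * h x)"
      using g h indefinite_integral_continuous_1[of g a b]
      by (intro borel_integrable_atLeastAtMost' continuous_intros) (auto simp: absolutely_integrable_on_def)
    ultimately show ?thesis
      using set_borel_integral_eq_integral(2)[OF si] by (simp add: set_lebesgue_integral_def)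
  qed
  also have "\<dots> = (LINT y|lborel. LINT x|lborel. F x y)"
    by (rule lborel_pair.Fubini_integral[OF Fi, symmetric])
  also have "\<dots> = integral {a..b} (\<lambda>y. g y * integral {y..b} h)"
  proof -
    have inner: "(LINT x|lborel. F x y) = G y * integral {y..b} h" for y
    proof (cases "y \<in> {a..b}")
      case True
      have "(LINT x|lborel. F x y) = G y * (LINT x:{y..}|lborel. H x)"
        unfolding set_lebesgue_integral_def integral_mult_right_zero[symmetric]
        by (intro Bochner_Integration.integral_cong) (auto simp: F_def indicator_def)
      also have "{y..} \<inter> {a..b} = {y..b}" using True by auto
      then have "(LINT x:{y..}|lborel. H x) = integral {y..b} h" 
        using HS[of "{y..}"] by (simp only: borel_closed closed_atLeast)
      finally show ?thesis .
    qed (simp add: F_def G)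
    have Gh: "integrable lborel (\<lambda>y. G y * integral {y..b} h)"
      using lborel_pair.integrable_snd[OF Fi] by (simp add: inner)
    have "(LINT y|lborel. LINT x|lborel. F x y) = (LINT y|lborel. G y * integral {y..b} h)"
      by (simp add: inner)
    \<comment> \<open>The integral moves to the completed measure, because the original g, which
      replaces its Borel representative next, need not be measurable for
      \<open>lborel\<close>.\<close>
    also have "\<dots> = (LINT y|lebesgue. G y * integral {y..b} h)"
      by (rule integral_completion[symmetric, OF borel_measurable_integrable[OF Gh]])
    also have "\<dots> = (LINT y|lebesgue. indicator {a..b} y *\<^sub>R (g y * integral {y..b} h))"
    proof (rule integral_cong_AE)
      have cont: "continuous_on {a..b} (\<lambda>y. integral {y..b} h)"
        using hi by (intro indefinite_integral_continuous_1') (auto simp: absolutely_integrable_on_def)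
      show "(\<lambda>y. indicator {a..b} y *\<^sub>R (g y * integral {y..b} h)) \<in> borel_measurable lebesgue"
        using absolutely_integrable_continuous_mult[OF g cont] by (auto simp: set_integrable_def)
      show "(\<lambda>y. G y * integral {y..b} h) \<in> borel_measurable lebesgue"
        by (rule measurable_completion[OF borel_measurable_integrable[OF Gh]])
      show "AE y in lebesgue. G y * integral {y..b} h = indicator {a..b} y *\<^sub>R (g y * integral {y..b} h)"
        using G_g by eventually_elim (use G(2) in \<open>auto simp: indicator_def\<close>)
    qed
    also have "\<dots> = integral {a..b} (\<lambda>y. g y * integral {y..b} h)"
    proof -
      have cont: "continuous_on {a..b} (\<lambda>y. integral {y..b} h)"
        using hi by (intro indefinite_integral_continuous_1') (auto simp: absolutely_integrable_on_def)
      show ?thesis using set_lebesgue_integral_eq_integral(2)[OF absolutely_integrable_continuous_mult[OF g cont]]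
        by (simp add: set_lebesgue_integral_def)
    qed
    finally show ?thesis .
  qed
  finally show ?thesis .
qed

text \<open>The integrals of the Borel representative over half-lines all vanish. Half-lines are
  stable under intersection and generate the Borel sets, so the integral over every Borel set
  vanishes, and a density with this property is zero almost everywhere.\<close>

lemma AE_zero_if_primitive_zero:
  fixes g :: "real \<Rightarrow> real"
  assumes g: "g absolutely_integrable_on {a..b}" and 0: "\<And>x. x \<in> {a..b} \<Longrightarrow> integral {a..x} g = 0"
  shows "AE x in lebesgue_on {a<..<b}. g x = 0"
proof -
  obtain G where G: "integrable lborel G"
    "\<And>S. S \<in> sets borel \<Longrightarrow> (LINT x:S|lborel. G x) = integral (S \<inter> {a..b}) g"
    and G_g: "AE x in lebesgue. x \<in> {a..b} \<longrightarrow> G x = g x"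
    using absolutely_integrable_Icc_borel[OF g] by metis
  have sets_eq: "sets borel = sigma_sets UNIV (range (\<lambda>a::real. {..a}))"
    by (subst borel_eq_atMost) (rule sets_measure_of, simp)
  have all0: "integral {a..b} g = 0"
    using 0[of b] by (cases "a \<le> b") auto
  have "(LINT x:S|lborel. G x) = 0" if "S \<in> sets borel" for S :: "real set"
  proof -
    have "Int_stable (range (\<lambda>a::real. {..a}))"
      by (auto simp: Int_stable_def Int_atMost)
    moreover have "range (\<lambda>a::real. {..a}) \<subseteq> Pow UNIV" by auto
    moreover have "S \<in> sigma_sets UNIV (range (\<lambda>a::real. {..a}))" using that sets_eq by simp
    ultimately show ?thesis
    proof (induction rule: sigma_sets_induct_disjoint)
      case (basic A)
      then obtain x where x: "A = {..x}" by auto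
      have "integral ({..x} \<inter> {a..b}) g = 0"
      proof (cases "x \<in> {a..b}")
        case True
        then have "{..x} \<inter> {a..b} = {a..x}" by auto
        then show ?thesis using 0 True by simp
      next
        case False
        then have "{..x} \<inter> {a..b} = {} \<or> {..x} \<inter> {a..b} = {a..b}" by auto
        then show ?thesis using all0 by auto
      qed
      then show ?case using G(2)[of "{..x}"] x by simp
    next
      case empty then show ?case by (simp add: set_lebesgue_integral_def)
    next
      case (compl A)
      then have A: "A \<in> sets borel" using sets_eq by simp
      have si: "set_integrable lborel T G" if "T \<in> sets borel" for T
        unfolding set_integrable_def using G(1) that by (intro integrable_mult_indicator) auto
      have "(LINT x:(A \<union> (UNIV - A))|lborel. G x) = (LINT x:A|lborel. G x) + (LINT x:(UNIV - A)|lborel. G x)"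
        using A by (intro set_integral_Un si) auto
      moreover have "(LINT x:UNIV|lborel. G x) = 0" using G(2)[of UNIV] all0 by simp
      ultimately show ?case using compl by simp
    next
      case (union A)
      then have A: "A i \<in> sets borel" for i using sets_eq by auto
      have "(LINT x:(\<Union>i. A i)|lborel. G x) = (\<Sum>i. (LINT x:(A i)|lborel. G x))"
      proof (rule lebesgue_integral_countable_add)
        show "set_integrable lborel (\<Union>i. A i) G" unfolding set_integrable_def
          using A G(1) by (intro integrable_mult_indicator) auto
      qed (use A union(1) in \<open>auto simp: disjoint_family_on_def\<close>)
      then show ?case using union by simp
    qed
  qed
  then have "AE x in lborel. G x = 0" using sigma_finite_measure.density_zero[OF lborel.sigma_finite_measure_axioms G(1)] by simp
  then have "AE x in lebesgue. G x = 0" by (rule AE_completion)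
  with G_g have "AE x in lebesgue. x \<in> {a<..<b} \<longrightarrow> g x = 0" by eventually_elim auto
  then show ?thesis by (simp add: AE_restrict_space_iff)
qed

section \<open>One-dimensional Sobolev functions\<close>

lemma test_functionD:
  assumes "test_function a b \<psi>"
  shows "(\<psi> has_real_derivative deriv \<psi> x) (at x)"
    and "continuous_on S (deriv \<psi>)" and "continuous_on S \<psi>"
    and "x \<notin> {a<..<b} \<Longrightarrow> \<psi> x = 0"
proof -
  show d: "(\<psi> has_real_derivative deriv \<psi> x) (at x)" for x
    using assms by (simp add: test_function_def DERIV_deriv_iff_real_differentiable)
  show "continuous_on S (deriv \<psi>)"
    using assms continuous_on_subset by (auto simp: test_function_def)
  show "continuous_on S \<psi>"
    using d by (intro continuous_at_imp_continuous_on) (auto intro: DERIV_isCont)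
  show "\<psi> x = 0" if "x \<notin> {a<..<b}"
    using assms that by (auto simp: test_function_def)
qed

lemma integral_deriv_eq_diff:
  fixes \<psi> h :: "real \<Rightarrow> real"
  assumes "\<And>x. (\<psi> has_real_derivative h x) (at x)" and "y \<le> z"
  shows "integral {y..z} h = \<psi> z - \<psi> y"
proof (rule integral_unique, rule fundamental_theorem_of_calculus)
  show "(\<psi> has_vector_derivative h x) (at x within {y..z})" for x
    using assms(1)[of x] has_field_derivative_at_within
    by (auto simp: has_real_derivative_iff_has_vector_derivative[symmetric])
qed fact

lemma absolutely_integrable_imp_locally_integrable:
  assumes "g absolutely_integrable_on {a..b}"
  shows "locally_integrable_on a b g"
  unfolding locally_integrable_on_def
proof safe
  fix K :: "real set" assume K: "compact K" "K \<subseteq> {a<..<b}"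
  then have "K \<in> sets lebesgue" "K \<subseteq> {a..b}" by (auto simp: lmeasurable_compact fmeasurableD)
  then show "integrable (lebesgue_on K) g"
    using set_integrable_subset[OF assms] absolutely_integrable_imp_integrable by blast
qed

lemma primitive_continuous:
  fixes u g :: "real \<Rightarrow> real"
  assumes "g absolutely_integrable_on {a..b}" and "\<And>x. x \<in> {a..b} \<Longrightarrow> u x = c + integral {a..x} g"
  shows "continuous_on {a..b} u"
proof -
  have "continuous_on {a..b} (\<lambda>x. c + integral {a..x} g)"
    using assms(1) by (intro continuous_intros indefinite_integral_continuous_1)
      (auto simp: absolutely_integrable_on_def)
  then show ?thesis by (rule continuous_on_eq) (simp add: assms(2))
qed

text \<open>\<open>integral_primitive_mult\<close> with h the derivative of \<psi>: the tail
  integral from y is -\<psi>(y), since \<psi> vanishes at b, and the constant c is annihilated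
  because that derivative has integral zero.\<close>

lemma primitive_is_weak_deriv:
  assumes ab: "a \<le> b" and g: "g absolutely_integrable_on {a..b}"
    and u: "\<And>x. x \<in> {a..b} \<Longrightarrow> u x = c + integral {a..x} g"
  shows "is_weak_deriv a b u g"
proof -
  have cu: "continuous_on {a..b} u" by (rule primitive_continuous[OF g u])
  have "(LINT x|lebesgue_on {a<..<b}. u x * deriv \<psi> x) = - (LINT x|lebesgue_on {a<..<b}. g x * \<psi> x)"
    if \<psi>: "test_function a b \<psi>" for \<psi>
  proof -
    note t = test_functionD[OF \<psi>]
    have z: "\<psi> a = 0" "\<psi> b = 0" using t(4) by auto
    have cp: "continuous_on {a..b} (\<lambda>x. integral {a..x} g)"
      using g by (intro indefinite_integral_continuous_1) (auto simp: absolutely_integrable_on_def)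
    have "(LINT x|lebesgue_on {a<..<b}. u x * deriv \<psi> x) = integral {a..b} (\<lambda>x. u x * deriv \<psi> x)"
      by (intro integral_lebesgue_on_Ioo absolutely_integrable_continuous_real continuous_intros cu t)
    also have "\<dots> = integral {a..b} (\<lambda>x. c * deriv \<psi> x + integral {a..x} g * deriv \<psi> x)"
      by (intro integral_cong) (simp add: u algebra_simps)
    also have "\<dots> = c * integral {a..b} (deriv \<psi>) + integral {a..b} (\<lambda>x. integral {a..x} g * deriv \<psi> x)"
      by (subst integral_add) (auto intro!: integrable_continuous_real continuous_intros cp t)
    also have "integral {a..b} (deriv \<psi>) = 0"
      using integral_deriv_eq_diff[OF t(1) ab] z by simp
    also have "integral {a..b} (\<lambda>x. integral {a..x} g * deriv \<psi> x)
      = integral {a..b} (\<lambda>y. g y * integral {y..b} (deriv \<psi>))"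
      by (rule integral_primitive_mult[OF g t(2)])
    also have "\<dots> = integral {a..b} (\<lambda>y. - (g y * \<psi> y))"
      by (intro integral_cong) (use integral_deriv_eq_diff[OF t(1)] z in auto)
    also have "\<dots> = - (LINT x|lebesgue_on {a<..<b}. g x * \<psi> x)"
      by (subst integral_lebesgue_on_Ioo) (auto intro!: absolutely_integrable_continuous_mult g t)
    finally show ?thesis by simp
  qed
  then show ?thesis unfolding is_weak_deriv_def
    using absolutely_integrable_imp_locally_integrable[OF g]
      absolutely_integrable_imp_locally_integrable[OF absolutely_integrable_continuous_real[OF cu]]
    by blast
qed

lemma weak_deriv_absolutely_integrable:
  assumes "is_weak_deriv a b u g" "a < \<alpha>" "\<beta> < b"
  shows "g absolutely_integrable_on {\<alpha>..\<beta>}"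
proof -
  have "{\<alpha>..\<beta>} \<subseteq> {a<..<b}" using assms by auto
  then have "integrable (lebesgue_on {\<alpha>..\<beta>}) g"
    using assms(1) compact_Icc unfolding is_weak_deriv_def locally_integrable_on_def by blast
  then show ?thesis by (simp add: set_integrable_def integrable_restrict_space)
qed

lemma absolutely_integrable_imp_integrable_subinterval:
  fixes f :: "real \<Rightarrow> real"
  assumes "f absolutely_integrable_on {a..b}" "{c..d} \<subseteq> {a..b}"
  shows "f integrable_on {c..d}"
  using absolutely_integrable_on_subinterval[OF assms] by (rule set_lebesgue_integral_eq_integral(1))

lemma integral_lebesgue_on_subinterval:
  fixes F :: "real \<Rightarrow> real"
  assumes "{\<alpha><..<\<beta>} \<subseteq> {a<..<b}" "\<And>x. x \<notin> {\<alpha><..<\<beta>} \<Longrightarrow> F x = 0"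
  shows "(LINT x|lebesgue_on {a<..<b}. F x) = (LINT x|lebesgue_on {\<alpha><..<\<beta>}. F x)"
proof -
  have "(LINT x|lebesgue_on {a<..<b}. F x) = (LINT x|lebesgue. indicator {a<..<b} x *\<^sub>R F x)"
    by (rule integral_restrict_space) simp
  also have "\<dots> = (LINT x|lebesgue. indicator {\<alpha><..<\<beta>} x *\<^sub>R F x)"
  proof (rule Bochner_Integration.integral_cong)
    show "indicator {a<..<b} x *\<^sub>R F x = indicator {\<alpha><..<\<beta>} x *\<^sub>R F x" for x
      using assms by (cases "x \<in> {\<alpha><..<\<beta>}") (auto simp: indicator_def)
  qed simp
  also have "\<dots> = (LINT x|lebesgue_on {\<alpha><..<\<beta>}. F x)"
    by (rule integral_restrict_space[symmetric]) simp
  finally show ?thesis .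
qed

text \<open>The lemma of du Bois-Reymond, tested with a function whose derivative is the deviation of
  \<open>u - \<integral> g\<close> from its weighted mean, so that the weak identity becomes the vanishing of a
  weighted variance.\<close>

lemma weak_deriv_primitive_local:
  assumes wd: "is_weak_deriv a b u g" and u: "continuous_on {a<..<b} u"
    and ab: "a < \<alpha>" "\<alpha> < \<beta>" "\<beta> < b"
  shows "\<exists>c. \<forall>x\<in>{\<alpha><..<\<beta>}. u x = c + integral {\<alpha>..x} g"
proof -
  have sub: "{\<alpha>..\<beta>} \<subseteq> {a<..<b}" using ab by auto
  have g: "g absolutely_integrable_on {\<alpha>..\<beta>}"
    using weak_deriv_absolutely_integrable[OF wd] ab by blast
  define w where "w = (\<lambda>x. u x - integral {\<alpha>..x} g)"
  have cP: "continuous_on {\<alpha>..\<beta>} (\<lambda>x. integral {\<alpha>..x} g)"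
    using g by (intro indefinite_integral_continuous_1) (auto simp: absolutely_integrable_on_def)
  have cu: "continuous_on {\<alpha>..\<beta>} u" using u sub continuous_on_subset by blast
  have cw: "continuous_on {\<alpha>..\<beta>} w" unfolding w_def by (intro continuous_intros cP cu)
  \<comment> \<open>A weight that is positive inside and zero outside the interval, so that
    \<open>h\<close> below extends continuously by zero and its antiderivative is a genuine C^1 test
    function.\<close>
  define \<eta> where "\<eta> = (\<lambda>x. max 0 (x - \<alpha>) * max 0 (\<beta> - x))"
  have c\<eta>: "continuous_on S \<eta>" for S unfolding \<eta>_def by (intro continuous_intros)
  have \<eta>0: "0 \<le> \<eta> x" for x by (simp add: \<eta>_def)
  have \<eta>out: "\<eta> x = 0" if "x \<notin> {\<alpha><..<\<beta>}" for x using that by (auto simp: \<eta>_def max_def)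
  have \<eta>in: "0 < \<eta> x" if "x \<in> {\<alpha><..<\<beta>}" for x using that by (auto simp: \<eta>_def max_def)
  define I where "I = integral {\<alpha>..\<beta>} \<eta>"
  have "I \<noteq> 0"
    using integral_eq_0_iff[of \<alpha> \<beta> \<eta>] c\<eta> \<eta>0 \<eta>in[of "(\<alpha> + \<beta>) / 2"] ab by (force simp: I_def)
  \<comment> \<open>The \<eta>-weighted mean of w. It makes the integral of \<open>h\<close> zero,
    and hence \<psi> vanishes to the right of \<beta> as well as to the left of \<alpha>.\<close>
  define c where "c = integral {\<alpha>..\<beta>} (\<lambda>x. w x * \<eta> x) / I"
  \<comment> \<open>The argument is clamped to the interval because w is known to be continuous only
    there; the factor \<eta> removes the artificial values outside.\<close>
  define h where "h = (\<lambda>x. (w (max \<alpha> (min \<beta> x)) - c) * \<eta> x)"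
  have h_in: "h x = (w x - c) * \<eta> x" if "x \<in> {\<alpha>..\<beta>}" for x using that by (simp add: h_def)
  have h_out: "h x = 0" if "x \<notin> {\<alpha><..<\<beta>}" for x using \<eta>out[OF that] by (simp add: h_def)
  have ch: "continuous_on S h" for S
  proof -
    have "continuous_on S (\<lambda>x. w (max \<alpha> (min \<beta> x)))"
      by (rule continuous_on_compose2[OF cw]) (use ab in \<open>auto intro!: continuous_intros\<close>)
    then show ?thesis unfolding h_def by (intro continuous_intros c\<eta>)
  qed
  have int_h: "integral {\<alpha>..\<beta>} h = 0"
  proof -
    have "integral {\<alpha>..\<beta>} h = integral {\<alpha>..\<beta>} (\<lambda>x. w x * \<eta> x - c * \<eta> x)"
      by (intro integral_cong) (simp add: h_in algebra_simps)
    also have "\<dots> = integral {\<alpha>..\<beta>} (\<lambda>x. w x * \<eta> x) - c * I"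
      unfolding I_def by (subst integral_diff) (auto intro!: integrable_continuous_real continuous_intros cw c\<eta>)
    finally show ?thesis using \<open>I \<noteq> 0\<close> by (simp add: c_def)
  qed
  have "isCont h x" for x using ch[of UNIV] by (simp add: continuous_on_eq_continuous_at)
  then obtain F where F: "\<And>x. (F has_real_derivative h x) (at x)"
    using einterval_antiderivative[of "-\<infinity>" \<infinity> h]
    by (auto simp: has_real_derivative_iff_has_vector_derivative)
  define \<psi> where "\<psi> = (\<lambda>x. F x - F \<alpha>)"
  have d\<psi>: "(\<psi> has_real_derivative h x) (at x)" for x
    unfolding \<psi>_def using F by (auto intro!: derivative_eq_intros)
  have \<psi>\<beta>: "\<psi> \<beta> = 0" using integral_deriv_eq_diff[OF d\<psi>, of \<alpha> \<beta>] ab int_h by (simp add: \<psi>_def)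
  have \<psi>_out: "\<psi> x = 0" if "x \<notin> {\<alpha><..<\<beta>}" for x
  proof (cases "x \<le> \<alpha>")
    case True
    have "integral {x..\<alpha>} h = integral {x..\<alpha>} (\<lambda>_. 0)" by (intro integral_cong h_out) auto
    then show ?thesis using integral_deriv_eq_diff[OF d\<psi> True] by (simp add: \<psi>_def)
  next
    case False
    then have x: "\<beta> \<le> x" using that by auto
    have "integral {\<beta>..x} h = integral {\<beta>..x} (\<lambda>_. 0)" by (intro integral_cong h_out) auto
    then show ?thesis using integral_deriv_eq_diff[OF d\<psi> x] \<psi>\<beta> by simp
  qed
  have deriv: "deriv \<psi> = h" using d\<psi> by (auto intro: DERIV_imp_deriv)
  have test: "test_function a b \<psi>"
    unfolding test_function_def deriv
  proof (intro conjI allI exI[of _ "{\<alpha>..\<beta>}"])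
    show "\<psi> differentiable (at x)" for x using d\<psi> real_differentiable_def by blast
  qed (use ch sub \<psi>_out in auto)
  have c\<psi>: "continuous_on S \<psi>" for S using test_functionD(3)[OF test] .
  have "(LINT x|lebesgue_on {a<..<b}. u x * h x) = - (LINT x|lebesgue_on {a<..<b}. g x * \<psi> x)"
    using wd test by (auto simp: is_weak_deriv_def deriv)
  moreover have "(LINT x|lebesgue_on {a<..<b}. u x * h x) = integral {\<alpha>..\<beta>} (\<lambda>x. u x * h x)"
    using sub ab by (subst integral_lebesgue_on_subinterval[of \<alpha> \<beta>])
      (auto simp: h_out intro!: integral_lebesgue_on_Ioo absolutely_integrable_continuous_real continuous_intros cu ch)
  moreover have "(LINT x|lebesgue_on {a<..<b}. g x * \<psi> x) = integral {\<alpha>..\<beta>} (\<lambda>x. g x * \<psi> x)"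
    using sub ab by (subst integral_lebesgue_on_subinterval[of \<alpha> \<beta>])
      (auto simp: \<psi>_out intro!: integral_lebesgue_on_Ioo absolutely_integrable_continuous_mult g c\<psi>)
  moreover have "integral {\<alpha>..\<beta>} (\<lambda>x. integral {\<alpha>..x} g * h x) = - integral {\<alpha>..\<beta>} (\<lambda>x. g x * \<psi> x)"
  proof -
    have "integral {\<alpha>..\<beta>} (\<lambda>y. g y * integral {y..\<beta>} h) = integral {\<alpha>..\<beta>} (\<lambda>y. - (g y * \<psi> y))"
      by (intro integral_cong) (use integral_deriv_eq_diff[OF d\<psi>] \<psi>\<beta> in auto)
    then show ?thesis using integral_primitive_mult[OF g ch] by simp
  qed
  moreover have "integral {\<alpha>..\<beta>} (\<lambda>x. u x * h x - integral {\<alpha>..x} g * h x)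
      = integral {\<alpha>..\<beta>} (\<lambda>x. u x * h x) - integral {\<alpha>..\<beta>} (\<lambda>x. integral {\<alpha>..x} g * h x)"
    by (intro integral_diff integrable_continuous_real continuous_intros cu cP ch)
  ultimately have "integral {\<alpha>..\<beta>} (\<lambda>x. w x * h x) = 0"
    by (simp add: w_def algebra_simps)
  moreover have "integral {\<alpha>..\<beta>} (\<lambda>x. w x * h x - c * h x) = integral {\<alpha>..\<beta>} (\<lambda>x. w x * h x) - c * integral {\<alpha>..\<beta>} h"
    by (subst integral_diff) (auto intro!: integrable_continuous_real continuous_intros cw ch)
  \<comment> \<open>Subtracting c times the vanishing integral of \<open>h\<close> completes the
    square and produces the weighted variance.\<close>
  moreover have "integral {\<alpha>..\<beta>} (\<lambda>x. w x * h x - c * h x) = integral {\<alpha>..\<beta>} (\<lambda>x. (w x - c)\<^sup>2 * \<eta> x)"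
    by (intro integral_cong) (simp add: h_in algebra_simps power2_eq_square)
  ultimately have "integral {\<alpha>..\<beta>} (\<lambda>x. (w x - c)\<^sup>2 * \<eta> x) = 0" using int_h by simp
  moreover have "continuous_on {\<alpha>..\<beta>} (\<lambda>x. (w x - c)\<^sup>2 * \<eta> x)"
    by (intro continuous_intros cw c\<eta>)
  ultimately have *: "(w x - c)\<^sup>2 * \<eta> x = 0" if "x \<in> {\<alpha>..\<beta>}" for x
    using integral_eq_0_iff[of \<alpha> \<beta> "\<lambda>x. (w x - c)\<^sup>2 * \<eta> x"] ab that \<eta>0 by auto
  have "w x = c" if "x \<in> {\<alpha><..<\<beta>}" for x
    using *[of x] \<eta>in[OF that] that by simp
  then have "\<forall>x\<in>{\<alpha><..<\<beta>}. u x = c + integral {\<alpha>..x} g"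
    unfolding w_def by (metis add.commute diff_add_cancel)
  then show ?thesis ..
qed

text \<open>The local representation is applied on an interval reaching halfway to a and b, so that
  x and y are both interior to it and share one additive constant, which then cancels.\<close>

lemma weak_deriv_primitive:
  assumes wd: "is_weak_deriv a b u g" and u: "continuous_on {a<..<b} u"
    and xy: "a < x" "x \<le> y" "y < b"
  shows "u y - u x = integral {x..y} g"
proof -
  define \<alpha> where "\<alpha> = (a + x) / 2"
  define \<beta> where "\<beta> = (b + y) / 2"
  have o: "a < \<alpha>" "\<alpha> < x" "y < \<beta>" "\<beta> < b" using xy by (auto simp: \<alpha>_def \<beta>_def)
  then obtain c where c: "\<And>x. x \<in> {\<alpha><..<\<beta>} \<Longrightarrow> u x = c + integral {\<alpha>..x} g"
    using weak_deriv_primitive_local[OF wd u, of \<alpha> \<beta>] xy by auto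
  have "g absolutely_integrable_on {\<alpha>..y}"
    using weak_deriv_absolutely_integrable[OF wd] o xy by auto
  then have "integral {\<alpha>..x} g + integral {x..y} g = integral {\<alpha>..y} g"
    using o xy by (intro Henstock_Kurzweil_Integration.integral_combine) (auto simp: absolutely_integrable_on_def)
  then show ?thesis using c[of x] c[of y] o xy by simp
qed

text \<open>Weak derivatives are only locally integrable, so the difference is shown to vanish on
  compact subintervals exhausting the open interval. On each of them its primitive is zero, since
  both candidates reproduce the same increments of u. Countably many null sets are then
  joined.\<close>

lemma weak_deriv_unique:
  assumes wd: "is_weak_deriv a b u g1" "is_weak_deriv a b u g2" and u: "continuous_on {a<..<b} u"
  shows "AE x in lebesgue_on {a<..<b}. g1 x = g2 x"
proof -
  define \<alpha> \<beta> where "\<alpha> = (\<lambda>n::nat. a + 1 / (n + 1))" and "\<beta> = (\<lambda>n::nat. b - 1 / (n + 1))"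
  have o: "a < \<alpha> n" "\<beta> n < b" for n by (auto simp: \<alpha>_def \<beta>_def)
  have "AE x in lebesgue. x \<in> {\<alpha> n<..<\<beta> n} \<longrightarrow> g1 x = g2 x" for n
  proof -
    have gi: "g1 absolutely_integrable_on {\<alpha> n..\<beta> n}" "g2 absolutely_integrable_on {\<alpha> n..\<beta> n}"
      using weak_deriv_absolutely_integrable wd o by blast+
    have "AE x in lebesgue_on {\<alpha> n<..<\<beta> n}. g1 x - g2 x = 0"
    proof (rule AE_zero_if_primitive_zero)
      show "(\<lambda>x. g1 x - g2 x) absolutely_integrable_on {\<alpha> n..\<beta> n}"
        using gi by (rule set_integral_diff)
      fix x assume x: "x \<in> {\<alpha> n..\<beta> n}"
      have "g1 integrable_on {\<alpha> n..x}" "g2 integrable_on {\<alpha> n..x}"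
        using x by (auto intro: absolutely_integrable_imp_integrable_subinterval[OF gi(1)] absolutely_integrable_imp_integrable_subinterval[OF gi(2)])
      then have "integral {\<alpha> n..x} (\<lambda>x. g1 x - g2 x) = integral {\<alpha> n..x} g1 - integral {\<alpha> n..x} g2"
        by (rule integral_diff)
      then show "integral {\<alpha> n..x} (\<lambda>x. g1 x - g2 x) = 0"
        using weak_deriv_primitive[OF wd(1) u, of "\<alpha> n" x] weak_deriv_primitive[OF wd(2) u, of "\<alpha> n" x]
          x o[of n] by simp
    qed
    then show ?thesis by (simp add: AE_restrict_space_iff)
  qed
  then have "AE x in lebesgue. \<forall>n. x \<in> {\<alpha> n<..<\<beta> n} \<longrightarrow> g1 x = g2 x"
    by (subst AE_all_countable) blast
  then have "AE x in lebesgue. x \<in> {a<..<b} \<longrightarrow> g1 x = g2 x"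
  proof eventually_elim
    case (elim x)
    show ?case
    proof
      assume x: "x \<in> {a<..<b}"
      then have "0 < min (x - a) (b - x)" by auto
      then obtain n where "1 / real (Suc n) < min (x - a) (b - x)"
        using reals_Archimedean by (metis inverse_eq_divide)
      then have "x \<in> {\<alpha> n<..<\<beta> n}" by (auto simp: \<alpha>_def \<beta>_def add.commute)
      then show "g1 x = g2 x" using elim by blast
    qed
  qed
  then show ?thesis by (simp add: AE_restrict_space_iff)
qed

section \<open>L^p functions on a bounded interval\<close>

lemma borel_measurable_lebesgue_on_AE:
  fixes f g :: "real \<Rightarrow> real"
  assumes f: "f \<in> borel_measurable (lebesgue_on S)" and S: "S \<in> sets lebesgue"
    and ae: "AE x in lebesgue_on S. f x = g x"
  shows "g \<in> borel_measurable (lebesgue_on S)"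
proof -
  have "(\<lambda>x. if x \<in> S then f x else 0) \<in> borel_measurable lebesgue"
    using f S by (simp add: borel_measurable_if)
  moreover have "AE x in lebesgue. (if x \<in> S then f x else 0) = (if x \<in> S then g x else 0)"
    using ae S by (auto simp: AE_restrict_space_iff elim: eventually_mono)
  ultimately have "(\<lambda>x. if x \<in> S then g x else 0) \<in> borel_measurable lebesgue"
    by (rule borel_measurable_AE)
  then show ?thesis using S by (simp add: borel_measurable_if)
qed

lemma Lp_on_AE:
  assumes f: "Lp_on p a b f" and ae: "AE x in lebesgue_on {a<..<b}. f x = g x"
  shows "Lp_on p a b g"
proof -
  have m: "g \<in> borel_measurable (lebesgue_on {a<..<b})"
    using f unfolding Lp_on_def by (intro borel_measurable_lebesgue_on_AE[OF _ _ ae]) auto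
  moreover have "integrable (lebesgue_on {a<..<b}) (\<lambda>x. \<bar>g x\<bar> powr p)"
  proof (rule integrable_cong_AE_imp)
    show "integrable (lebesgue_on {a<..<b}) (\<lambda>x. \<bar>f x\<bar> powr p)" using f by (simp add: Lp_on_def)
    show "(\<lambda>x. \<bar>g x\<bar> powr p) \<in> borel_measurable (lebesgue_on {a<..<b})" using m by simp
    show "AE x in lebesgue_on {a<..<b}. \<bar>f x\<bar> powr p = \<bar>g x\<bar> powr p"
      using ae by eventually_elim simp
  qed
  ultimately show ?thesis by (simp add: Lp_on_def)
qed

lemma finite_measure_lebesgue_on_Ioo [simp]: "finite_measure (lebesgue_on {a<..<b::real})"
  by (intro finite_measure_lebesgue_on) simp

lemma integrable_const_Ioo [simp]: "integrable (lebesgue_on {a<..<b::real}) (\<lambda>_. c::real)"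
  using finite_measure.integrable_const[OF finite_measure_lebesgue_on_Ioo] .

lemma Lp_on_integrable:
  assumes "1 < p" "Lp_on p a b g"
  shows "integrable (lebesgue_on {a<..<b}) g"
proof (rule Bochner_Integration.integrable_bound)
  show "integrable (lebesgue_on {a<..<b}) (\<lambda>x. 1 + \<bar>g x\<bar> powr p)"
    using assms by (intro Bochner_Integration.integrable_add) (auto simp: Lp_on_def)
  show "AE x in lebesgue_on {a<..<b}. norm (g x) \<le> norm (1 + \<bar>g x\<bar> powr p)"
  proof (rule AE_I2)
    fix x
    have "\<bar>g x\<bar> \<le> 1 + \<bar>g x\<bar> powr p"
    proof (cases "\<bar>g x\<bar> \<le> 1")
      case False
      then have "\<bar>g x\<bar> powr 1 \<le> \<bar>g x\<bar> powr p" using assms by (intro powr_mono) auto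
      then show ?thesis using False by simp
    qed (smt (verit) powr_ge_zero)
    then show "norm (g x) \<le> norm (1 + \<bar>g x\<bar> powr p)" by simp
  qed
qed (use assms in \<open>simp add: Lp_on_def\<close>)

lemma Lp_on_lincomb:
  assumes "1 < p" "Lp_on p a b f" "Lp_on p a b g"
  shows "Lp_on p a b (\<lambda>x. s * f x + t * g x)"
  unfolding Lp_on_def
proof
  show m: "(\<lambda>x. s * f x + t * g x) \<in> borel_measurable (lebesgue_on {a<..<b})"
    using assms by (auto simp: Lp_on_def)
  show "integrable (lebesgue_on {a<..<b}) (\<lambda>x. \<bar>s * f x + t * g x\<bar> powr p)"
  proof (rule Bochner_Integration.integrable_bound)
    show "integrable (lebesgue_on {a<..<b})
        (\<lambda>x. 2 powr p * (\<bar>s\<bar> powr p * \<bar>f x\<bar> powr p + \<bar>t\<bar> powr p * \<bar>g x\<bar> powr p))"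
      using assms by (auto simp: Lp_on_def)
    have "\<bar>s * f x + t * g x\<bar> powr p \<le> 2 powr p * (\<bar>s\<bar> powr p * \<bar>f x\<bar> powr p + \<bar>t\<bar> powr p * \<bar>g x\<bar> powr p)" for x
      using powr_abs_le_sum[of p "s * f x" "t * g x"] assms(1) by (simp add: abs_mult powr_mult)
    then show "AE x in lebesgue_on {a<..<b}. norm (\<bar>s * f x + t * g x\<bar> powr p) \<le>
        norm (2 powr p * (\<bar>s\<bar> powr p * \<bar>f x\<bar> powr p + \<bar>t\<bar> powr p * \<bar>g x\<bar> powr p))"
      by (intro AE_I2) (metis abs_ge_self abs_of_nonneg order.trans powr_ge_zero real_norm_def)
  qed (use m in simp)
qed

lemma Lp_on_continuous:
  assumes "1 < p" "continuous_on {a..b} u"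
  shows "Lp_on p a b u"
  unfolding Lp_on_def
proof
  show "u \<in> borel_measurable (lebesgue_on {a<..<b})"
    using assms by (intro continuous_imp_measurable_on_sets_lebesgue continuous_on_subset[OF assms(2)]) auto
  have "continuous_on {a..b} (\<lambda>x. \<bar>u x\<bar> powr p)"
    using assms by (intro continuous_on_powr' continuous_intros) auto
  then show "integrable (lebesgue_on {a<..<b}) (\<lambda>x. \<bar>u x\<bar> powr p)"
    by (simp add: integrable_lebesgue_on_Ioo_iff absolutely_integrable_continuous_real)
qed

text \<open>The absolutely continuous form of a Sobolev function with its derivative carried as
  data. Linear combinations act on both components exactly, and u is constrained pointwise on the
  closed interval, so its end values are meaningful.\<close>

definition sobolev_pair :: "real \<Rightarrow> real \<Rightarrow> (real \<Rightarrow> real) \<Rightarrow> (real \<Rightarrow> real) \<Rightarrow> bool" where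
  "sobolev_pair p l u g \<longleftrightarrow> Lp_on p 0 l g \<and> (\<forall>x\<in>{0..l}. u x = u 0 + integral {0..x} g)"

lemma sobolev_pairD:
  assumes "sobolev_pair p l u g"
  shows "Lp_on p 0 l g" and "\<And>x. x \<in> {0..l} \<Longrightarrow> u x = u 0 + integral {0..x} g"
  using assms unfolding sobolev_pair_def by blast+

lemma sobolev_pair_integrable:
  assumes "1 < p" "sobolev_pair p l u g"
  shows "g absolutely_integrable_on {0..l}"
  using Lp_on_integrable[OF assms(1) sobolev_pairD(1)[OF assms(2)]]
  by (simp add: integrable_lebesgue_on_Ioo_iff)

lemma sobolev_pair_continuous:
  assumes "1 < p" "sobolev_pair p l u g"
  shows "continuous_on {0..l} u"
  by (rule primitive_continuous[OF sobolev_pair_integrable[OF assms] sobolev_pairD(2)[OF assms(2)]])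

lemma sobolev_pair_weak_deriv:
  assumes p: "1 < p" and l: "0 < l" and u: "sobolev_pair p l u g"
  shows "W1p_on p 0 l u" "AE x in lebesgue_on {0<..<l}. weak_deriv 0 l u x = g x"
proof -
  have wd: "is_weak_deriv 0 l u g"
    using less_imp_le[OF l] sobolev_pair_integrable[OF p u] sobolev_pairD(2)[OF u]
    by (rule primitive_is_weak_deriv)
  then show "W1p_on p 0 l u"
    using sobolev_pairD(1)[OF u] Lp_on_continuous[OF p sobolev_pair_continuous[OF p u]]
    by (auto simp: W1p_on_def)
  have "is_weak_deriv 0 l u (weak_deriv 0 l u)"
    unfolding weak_deriv_def using wd by (rule someI[where P = "is_weak_deriv 0 l u"])
  then show "AE x in lebesgue_on {0<..<l}. weak_deriv 0 l u x = g x"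
    using wd continuous_on_subset[OF sobolev_pair_continuous[OF p u] greaterThanLessThan_subseteq_atLeastAtMost_iff[THEN iffD2]]
    by (intro weak_deriv_unique) auto
qed

text \<open>In the interior u and the primitive of its weak derivative differ by a constant. The end
  points, which test functions do not see, are reached because both functions are continuous on the
  closed interval.\<close>

lemma W1p_sobolev_pair:
  assumes p: "1 < p" and l: "0 < l" and u: "W1p_on p 0 l u" "continuous_on {0..l} u"
  shows "sobolev_pair p l u (weak_deriv 0 l u)"
proof -
  obtain g where g: "is_weak_deriv 0 l u g" "Lp_on p 0 l g" using u by (auto simp: W1p_on_def)
  define h where "h = weak_deriv 0 l u"
  have h: "is_weak_deriv 0 l u h" unfolding h_def weak_deriv_def using g(1) by (rule someI[where P = "is_weak_deriv 0 l u"])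
  have cu: "continuous_on {0<..<l} u" using u(2) by (rule continuous_on_subset) auto
  \<comment> \<open>The choice in \<open>weak_deriv\<close> promises no integrability beyond the
    local one; the L^p bound is inherited from the witness g, which agrees with h almost
    everywhere.\<close>
  have Lp: "Lp_on p 0 l h" using g weak_deriv_unique[OF g(1) h cu] Lp_on_AE by blast
  then have hi: "h absolutely_integrable_on {0..l}"
    using Lp_on_integrable[OF p] by (simp add: integrable_lebesgue_on_Ioo_iff)
  define D where "D = (\<lambda>x. u x - integral {0..x} h)"
  have D: "D x = D (l / 2)" if "x \<in> {0<..<l}" for x
  proof -
    have *: "D y = D z" if "0 < y" "y \<le> z" "z < l" for y z
    proof -
      have "h integrable_on {0..z}"
        using that by (intro absolutely_integrable_imp_integrable_subinterval[OF hi]) auto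
      then have "integral {0..y} h + integral {y..z} h = integral {0..z} h"
        using that by (intro Henstock_Kurzweil_Integration.integral_combine) auto
      then show ?thesis using weak_deriv_primitive[OF h cu that] by (simp add: D_def)
    qed
    show ?thesis using *[of x "l/2"] *[of "l/2" x] that l by (cases "x \<le> l/2") auto
  qed
  have "closure {0<..<l} = {0..l}" using l by simp
  moreover have "continuous_on {0..l} D" unfolding D_def
    using hi u(2) by (intro continuous_intros indefinite_integral_continuous_1)
      (auto simp: absolutely_integrable_on_def)
  ultimately have *: "D x = D (l / 2)" if "x \<in> {0..l}" for x
    using continuous_constant_on_closure[of "{0<..<l}" D "D (l / 2)" x] D that by metis
  have "u x = u 0 + integral {0..x} h" if "x \<in> {0..l}" for x
  proof -
    have "D x = D 0" using *[OF that] *[of 0] l by (metis atLeastAtMost_iff less_imp_le order_refl)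
    moreover have "D 0 = u 0" by (simp add: D_def)
    ultimately show ?thesis unfolding D_def by linarith
  qed
  then show ?thesis using Lp by (simp only: sobolev_pair_def h_def[symmetric]) blast
qed

lemma sobolev_pair_lincomb:
  assumes p: "1 < p" and u: "sobolev_pair p l u g" and w: "sobolev_pair p l w h"
  shows "sobolev_pair p l (\<lambda>x. s * u x + t * w x) (\<lambda>x. s * g x + t * h x)"
  unfolding sobolev_pair_def
proof safe
  show "Lp_on p 0 l (\<lambda>x. s * g x + t * h x)"
    by (rule Lp_on_lincomb[OF p sobolev_pairD(1)[OF u] sobolev_pairD(1)[OF w]])
  fix x assume x: "x \<in> {0..l}"
  have "g integrable_on {0..x}" "h integrable_on {0..x}"
    using x by (auto intro!: absolutely_integrable_imp_integrable_subinterval[OF sobolev_pair_integrable[OF p u]]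
        absolutely_integrable_imp_integrable_subinterval[OF sobolev_pair_integrable[OF p w]])
  then have "integral {0..x} (\<lambda>x. s * g x + t * h x) = s * integral {0..x} g + t * integral {0..x} h"
    by (intro integral_unique has_integral_add has_integral_mult_right integrable_integral)
  moreover have "u x = u 0 + integral {0..x} g" "w x = w 0 + integral {0..x} h"
    using u w x unfolding sobolev_pair_def by blast+
  ultimately show "s * u x + t * w x = s * u 0 + t * w 0 + integral {0..x} (\<lambda>x. s * g x + t * h x)"
    by (simp add: algebra_simps)
qed

section \<open>The energy of an edge\<close>

text \<open>The Riesz-Fischer argument. Summable steps make the telescoping series converge
  absolutely almost everywhere, so the sequence itself converges there without a further
  subsequence, and the sum of the absolute steps dominates the error.\<close>

lemma L1_complete:
  fixes g :: "nat \<Rightarrow> 'a \<Rightarrow> real"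
  assumes g: "\<And>n. integrable M (g n)"
    and fast: "\<And>n. (LINT x|M. \<bar>g (Suc n) x - g n x\<bar>) \<le> (1/2)^n"
  obtains h where "integrable M h" "AE x in M. (\<lambda>n. g n x) \<longlonglongrightarrow> h x"
    "(\<lambda>n. LINT x|M. \<bar>g n x - h x\<bar>) \<longlonglongrightarrow> 0"
proof -
  define D where "D = (\<lambda>n x. g (Suc n) x - g n x)"
  have Di: "integrable M (D n)" for n unfolding D_def using g by simp
  have sD: "summable (\<lambda>n. LINT x|M. norm (D n x))"
  proof (rule summable_comparison_test[OF _ summable_geometric[of "1/2 :: real"]])
    show "\<exists>N. \<forall>n\<ge>N. norm (LINT x|M. norm (D n x)) \<le> (1/2)^n"
      using fast by (auto simp: D_def)
  qed simp
  have aeD: "AE x in M. summable (\<lambda>n. norm (D n x))"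
  proof -
    have [measurable]: "D n \<in> borel_measurable M" for n using Di by simp
    have "(\<integral>\<^sup>+x. (\<Sum>n. ennreal (norm (D n x))) \<partial>M) = (\<Sum>n. \<integral>\<^sup>+x. ennreal (norm (D n x)) \<partial>M)"
      by (rule nn_integral_suminf) measurable
    also have "\<dots> = (\<Sum>n. ennreal (LINT x|M. norm (D n x)))"
      using Di by (subst nn_integral_eq_integral) auto
    also have "\<dots> = ennreal (\<Sum>n. LINT x|M. norm (D n x))"
      by (intro suminf_ennreal2 sD) auto
    finally have "(\<integral>\<^sup>+x. (\<Sum>n. ennreal (norm (D n x))) \<partial>M) \<noteq> \<infinity>" by simp
    then have "AE x in M. (\<Sum>n. ennreal (norm (D n x))) \<noteq> \<infinity>"
      by (intro nn_integral_PInf_AE) auto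
    then show ?thesis
      by eventually_elim (intro summable_suminf_not_top, auto)
  qed
  define h where "h = (\<lambda>x. g 0 x + (\<Sum>n. D n x))"
  have hi: "integrable M h" unfolding h_def
    using integrable_suminf[OF Di aeD sD] g by simp
  have gsum: "g n x = g 0 x + (\<Sum>i<n. D i x)" for n x
    unfolding D_def by (induction n) auto
  have lim: "AE x in M. (\<lambda>n. g n x) \<longlonglongrightarrow> h x"
    using aeD
  proof eventually_elim
    case (elim x)
    have "(\<lambda>n. \<Sum>i<n. D i x) \<longlonglongrightarrow> (\<Sum>n. D n x)"
      by (rule summable_LIMSEQ[OF summable_norm_cancel[OF elim]])
    then have "(\<lambda>n. g 0 x + (\<Sum>i<n. D i x)) \<longlonglongrightarrow> h x"
      unfolding h_def by (intro tendsto_intros)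
    then show ?case by (simp only: gsum[symmetric])
  qed
  have "(\<lambda>n. LINT x|M. \<bar>g n x - h x\<bar>) \<longlonglongrightarrow> (LINT x|M. 0)"
  proof (rule integral_dominated_convergence)
    show "integrable M (\<lambda>x. \<Sum>n. norm (D n x))"
      by (rule integrable_suminf) (use Di aeD sD in auto)
    show "AE x in M. (\<lambda>n. \<bar>g n x - h x\<bar>) \<longlonglongrightarrow> 0"
      using lim by eventually_elim (simp add: LIM_zero_iff tendsto_rabs_zero_iff)
    show "AE x in M. norm \<bar>g n x - h x\<bar> \<le> (\<Sum>n. norm (D n x))" for n
      using aeD
    proof eventually_elim
      case (elim x)
      have sm: "summable (\<lambda>n. D n x)" using elim by (rule summable_norm_cancel)
      have "h x - g n x = (\<Sum>i. D (i + n) x)"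
        using suminf_split_initial_segment[OF sm, of n] gsum[of n x] by (simp add: h_def)
      then have "\<bar>g n x - h x\<bar> = norm (\<Sum>i. D (i + n) x)" by simp
      also have "\<dots> \<le> (\<Sum>i. norm (D (i + n) x))"
        using elim by (intro summable_norm) (rule summable_ignore_initial_segment)
      also have "\<dots> \<le> (\<Sum>i. norm (D i x))"
        using suminf_split_initial_segment[OF elim, of n] sum_nonneg[of "{..<n}" "\<lambda>i. norm (D i x)"]
        by simp
      finally show ?case by simp
    qed
  qed (use g hi in auto)
  then show ?thesis using that[OF hi lim] by simp
qed

text \<open>Integrability of the limit is part of the claim, hence the detour through extended
  nonnegative integrals: this is how the limiting derivative is recognised as an element of
  L^p.\<close>

lemma integral_Fatou:
  fixes k :: "nat \<Rightarrow> 'a \<Rightarrow> real"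
  assumes k: "\<And>n. integrable M (k n)" "\<And>n x. 0 \<le> k n x"
    and h: "h \<in> borel_measurable M" "AE x in M. (\<lambda>n. k n x) \<longlonglongrightarrow> h x" "\<And>x. 0 \<le> h x"
    and c: "(\<lambda>n. LINT x|M. k n x) \<longlonglongrightarrow> c"
  shows "integrable M h" "(LINT x|M. h x) \<le> c"
proof -
  have [measurable]: "k n \<in> borel_measurable M" for n using k by simp
  have c0: "0 \<le> c" using c k(2) by (intro LIMSEQ_le_const[OF c]) (auto intro!: integral_nonneg_AE)
  have "(\<integral>\<^sup>+x. ennreal (h x) \<partial>M) = (\<integral>\<^sup>+x. liminf (\<lambda>n. ennreal (k n x)) \<partial>M)"
  proof (rule nn_integral_cong_AE)
    show "AE x in M. ennreal (h x) = liminf (\<lambda>n. ennreal (k n x))"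
      using h(2) by eventually_elim (rule lim_imp_Liminf[OF _ tendsto_ennrealI, symmetric], simp)
  qed
  also have "\<dots> \<le> liminf (\<lambda>n. \<integral>\<^sup>+x. ennreal (k n x) \<partial>M)"
    by (rule nn_integral_liminf) measurable
  also have "\<dots> = liminf (\<lambda>n. ennreal (LINT x|M. k n x))"
    using k by (subst nn_integral_eq_integral) auto
  also have "\<dots> = ennreal c"
    by (rule lim_imp_Liminf[OF _ tendsto_ennrealI[OF c]]) simp
  finally have le: "(\<integral>\<^sup>+x. ennreal (h x) \<partial>M) \<le> ennreal c" .
  then have "(\<integral>\<^sup>+x. ennreal (norm (h x)) \<partial>M) < \<infinity>"
    using h(3) by (simp add: order_le_less_trans)
  then show hi: "integrable M h" using h(1) by (intro integrableI_bounded) auto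
  have "ennreal (LINT x|M. h x) \<le> ennreal c"
    using le nn_integral_eq_integral[OF hi] h(3) by simp
  then show "(LINT x|M. h x) \<le> c" using c0 by simp
qed

lemma continuous_imp_bounded_Icc:
  fixes h :: "real \<Rightarrow> real"
  assumes "continuous_on UNIV h"
  shows "\<exists>B. \<forall>s\<in>{a..b}. \<bar>h s\<bar> \<le> B"
proof -
  have "compact (h ` {a..b})"
    using assms by (intro compact_continuous_image continuous_on_subset[OF assms]) auto
  then show ?thesis by (auto dest!: compact_imp_bounded simp: bounded_iff)
qed

section \<open>Coercivity, convexity and directional derivative of the energy on one edge\<close>

definition sup_abs :: "real \<Rightarrow> (real \<Rightarrow> real) \<Rightarrow> real" where
  "sup_abs l u = (SUP x\<in>{0..l}. \<bar>u x\<bar>)"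

lemma sup_abs:
  assumes "0 < l" "continuous_on {0..l} u"
  shows "\<exists>y\<in>{0..l}. sup_abs l u = \<bar>u y\<bar>" "x \<in> {0..l} \<Longrightarrow> \<bar>u x\<bar> \<le> sup_abs l u" "0 \<le> sup_abs l u"
proof -
  have "continuous_on {0..l} (\<lambda>x. \<bar>u x\<bar>)" using assms by (intro continuous_intros)
  then obtain y where y: "y \<in> {0..l}" "\<And>x. x \<in> {0..l} \<Longrightarrow> \<bar>u x\<bar> \<le> \<bar>u y\<bar>"
    using continuous_attains_sup[of "{0..l}" "\<lambda>x. \<bar>u x\<bar>"] assms by auto
  then have *: "sup_abs l u = \<bar>u y\<bar>"
    unfolding sup_abs_def by (intro cSup_eq_maximum) auto
  then show "\<exists>y\<in>{0..l}. sup_abs l u = \<bar>u y\<bar>" "x \<in> {0..l} \<Longrightarrow> \<bar>u x\<bar> \<le> sup_abs l u" "0 \<le> sup_abs l u"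
    using y by auto
qed

text \<open>The potential \<Gamma> enters only through its subgradient inequality and its growth.
  The growth clause holds for every slope K, because K will be chosen large enough to beat the
  linear terms coming from f and from the vertex fluxes.\<close>

locale edge_problem =
  fixes p l :: real and \<gamma> \<Gamma> f :: "real \<Rightarrow> real"
  assumes p: "1 < p" and l: "0 < l"
    and \<gamma>_cont: "continuous_on UNIV \<gamma>" and \<gamma>_mono: "strict_mono \<gamma>"
    and \<Gamma>_cont: "continuous_on UNIV \<Gamma>"
    and \<Gamma>_sub: "\<Gamma> b - \<Gamma> a \<le> \<gamma> b * (b - a)"
    and \<Gamma>_superlinear: "\<exists>C. \<forall>s. K * \<bar>s\<bar> \<le> \<Gamma> s + C"
    and f: "integrable (lebesgue_on {0<..<l}) f"
begin

abbreviation "M \<equiv> lebesgue_on {0<..<l}"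

abbreviation "pair \<equiv> sobolev_pair p l"

definition energy :: "(real \<Rightarrow> real) \<Rightarrow> (real \<Rightarrow> real) \<Rightarrow> real" where
  "energy u g = (LINT x|M. \<bar>g x\<bar> powr p / p) + (LINT x|M. \<Gamma> (u x)) - (LINT x|M. f x * u x)"

lemma pair_cont: "pair u g \<Longrightarrow> continuous_on {0..l} u"
  by (rule sobolev_pair_continuous[OF p])

lemma pair_Lp: "pair u g \<Longrightarrow> integrable M (\<lambda>x. \<bar>g x\<bar> powr p)"
  using sobolev_pairD(1) by (auto simp: Lp_on_def)

lemma pair_meas: "pair u g \<Longrightarrow> g \<in> borel_measurable M"
  using sobolev_pairD(1) by (auto simp: Lp_on_def)

lemma pair_int: "pair u g \<Longrightarrow> integrable M g"
  using sobolev_pair_integrable[OF p] by (simp add: integrable_lebesgue_on_Ioo_iff)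

lemma integrable_cont: "continuous_on {0..l} h \<Longrightarrow> integrable M (h :: real \<Rightarrow> real)"
  by (simp add: integrable_lebesgue_on_Ioo_iff absolutely_integrable_continuous_real)

lemma integrable_comp: "continuous_on UNIV h \<Longrightarrow> continuous_on {0..l} u \<Longrightarrow> integrable M (\<lambda>x. h (u x :: real) :: real)"
  by (rule integrable_cont, rule continuous_on_compose2[of UNIV h]) auto

lemma integrable_mult_cont: "integrable M h \<Longrightarrow> continuous_on {0..l} u \<Longrightarrow> integrable M (\<lambda>x. h x * u x :: real)"
  by (simp add: integrable_lebesgue_on_Ioo_iff absolutely_integrable_continuous_mult)

lemma measure_M: "measure M {0<..<l} = l"
  using l by (simp add: measure_restrict_space)

text \<open>Used twice: it compares the maximum of |u| with the values of |u| elsewhere in the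
  coercivity estimate, and, applied to a difference of pairs, it turns L^1 convergence of
  derivatives into convergence of the functions at every point.\<close>

lemma pair_osc:
  assumes u: "pair u g" and x: "x \<in> {0..l}" "y \<in> {0..l}"
  shows "\<bar>u x - u y\<bar> \<le> (LINT z|M. \<bar>g z\<bar>)"
proof -
  have gi: "g absolutely_integrable_on {0..l}" by (rule sobolev_pair_integrable[OF p u])
  have *: "\<bar>u b - u a\<bar> \<le> (LINT z|M. \<bar>g z\<bar>)" if ab: "0 \<le> a" "a \<le> b" "b \<le> l" for a b
  proof -
    have i: "g integrable_on {0..b}" "g integrable_on {a..b}"
      "(\<lambda>z. \<bar>g z\<bar>) integrable_on {a..b}" "(\<lambda>z. \<bar>g z\<bar>) integrable_on {0..l}"
      using ab absolutely_integrable_imp_integrable_subinterval[OF gi]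
        absolutely_integrable_imp_integrable_subinterval[OF set_integrable_abs[OF gi]] by auto
    have "u b = u 0 + integral {0..b} g" "u a = u 0 + integral {0..a} g"
      by (rule sobolev_pairD(2)[OF u]; use ab in simp)+
    moreover have "integral {0..a} g + integral {a..b} g = integral {0..b} g"
      using ab i by (intro Henstock_Kurzweil_Integration.integral_combine)
    ultimately have "\<bar>u b - u a\<bar> = \<bar>integral {a..b} g\<bar>" by linarith
    also have "\<dots> \<le> integral {a..b} (\<lambda>z. \<bar>g z\<bar>)"
      using integral_norm_bound_integral[OF i(2,3)] by simp
    also have "\<dots> \<le> integral {0..l} (\<lambda>z. \<bar>g z\<bar>)"
      using ab i by (intro integral_subset_le) auto
    also have "\<dots> = (LINT z|M. \<bar>g z\<bar>)"
      using set_integrable_abs[OF gi] by (simp add: integral_lebesgue_on_Ioo)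
    finally show ?thesis .
  qed
  show ?thesis using *[of x y] *[of y x] x by (cases "x \<le> y") (auto simp: abs_minus_commute)
qed

lemma integral_f_le:
  assumes u: "continuous_on {0..l} u"
  shows "(LINT x|M. f x * u x) \<le> (LINT x|M. \<bar>f x\<bar>) * sup_abs l u"
proof -
  have "(LINT x|M. f x * u x) \<le> (LINT x|M. \<bar>f x\<bar> * sup_abs l u)"
  proof (rule integral_mono)
    show "integrable M (\<lambda>x. f x * u x)" by (rule integrable_mult_cont[OF f u])
    show "integrable M (\<lambda>x. \<bar>f x\<bar> * sup_abs l u)" using f by simp
    fix x assume "x \<in> space M"
    then have "\<bar>u x\<bar> \<le> sup_abs l u" by (intro sup_abs(2)[OF l u]) auto
    then have "\<bar>f x\<bar> * \<bar>u x\<bar> \<le> \<bar>f x\<bar> * sup_abs l u" by (intro mult_left_mono) auto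
    then show "f x * u x \<le> \<bar>f x\<bar> * sup_abs l u"
      using abs_ge_self[of "f x * u x"] by (simp add: abs_mult)
  qed
  then show ?thesis using f by simp
qed

lemma energy_coercive:
  assumes K: "0 \<le> K"
  obtains C where
    "\<And>u g. pair u g \<Longrightarrow> K * sup_abs l u + (LINT x|M. \<bar>g x\<bar> powr p) / (2 * p) \<le> energy u g + C"
proof -
  define F where "F = (LINT x|M. \<bar>f x\<bar>)"
  have F: "0 \<le> F" unfolding F_def by (intro integral_nonneg_AE) auto
  \<comment> \<open>The part F of k pays for the term with f, which is at most F times the maximum
    of |u|; the part K survives in the claim.\<close>
  define k where "k = K + F"
  have k: "0 \<le> k" using K F by (simp add: k_def)
  \<comment> \<open>The slope is divided by l because integrating over an interval of length l
    multiplies it back to k.\<close>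
  obtain C1 where C1: "\<And>s. k / l * \<bar>s\<bar> \<le> \<Gamma> s + C1" using \<Gamma>_superlinear by blast
  \<comment> \<open>The factor 2 p makes the oscillation cost k N at most Q / (2 p) plus a constant,
    that is, half of the p-energy Q / p. The other half stays in the claim.\<close>
  obtain C2 where C2: "\<And>s. 0 \<le> s \<Longrightarrow> (k * (2 * p)) * s \<le> s powr p + C2"
    using powr_superlinear[OF p] by metis
  show ?thesis
  proof
    fix u g assume u: "pair u g"
    note cu = pair_cont[OF u]
    define S where "S = sup_abs l u"
    define N where "N = (LINT x|M. \<bar>g x\<bar>)"
    define Q where "Q = (LINT x|M. \<bar>g x\<bar> powr p)"
    obtain y where y: "y \<in> {0..l}" "S = \<bar>u y\<bar>" using sup_abs(1)[OF l cu] by (auto simp: S_def)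
    have "(LINT x|M. k / l * (S - N)) \<le> (LINT x|M. \<Gamma> (u x) + C1)"
    proof (rule integral_mono)
      show "integrable M (\<lambda>x. \<Gamma> (u x) + C1)"
        using integrable_comp[OF \<Gamma>_cont cu] by (intro Bochner_Integration.integrable_add) auto
      fix x assume x: "x \<in> space M"
      have "S - N \<le> \<bar>u x\<bar>" using pair_osc[OF u, of y x] y x by (auto simp: N_def)
      then have "k / l * (S - N) \<le> k / l * \<bar>u x\<bar>" using k l by (intro mult_left_mono) auto
      then show "k / l * (S - N) \<le> \<Gamma> (u x) + C1" using C1[of "u x"] by linarith
    qed simp
    also have "\<dots> = (LINT x|M. \<Gamma> (u x)) + l * C1"
      using integrable_comp[OF \<Gamma>_cont cu] by (subst Bochner_Integration.integral_add) (auto simp: measure_M)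
    finally have 1: "k * (S - N) \<le> (LINT x|M. \<Gamma> (u x)) + l * C1"
      using l by (simp add: measure_M)
    have "(LINT x|M. (k * (2 * p)) * \<bar>g x\<bar>) \<le> (LINT x|M. \<bar>g x\<bar> powr p + C2)"
      using C2 pair_int[OF u] pair_Lp[OF u]
      by (intro integral_mono Bochner_Integration.integrable_add) auto
    also have "\<dots> = Q + l * C2"
      using pair_Lp[OF u] by (subst Bochner_Integration.integral_add) (auto simp: measure_M Q_def)
    finally have "(k * N) * (2 * p) \<le> Q + l * C2" by (simp add: N_def mult_ac)
    then have "k * N \<le> (Q + l * C2) / (2 * p)"
      using p by (subst pos_le_divide_eq) auto
    then have 2: "k * N \<le> Q / (2 * p) + l * C2 / (2 * p)"
      by (simp add: add_divide_distrib)
    have 3: "(LINT x|M. f x * u x) \<le> F * S" using integral_f_le[OF cu] by (simp add: F_def S_def)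
    have 4: "Q / p = Q / (2 * p) + Q / (2 * p)" by simp
    have "energy u g = Q / p + (LINT x|M. \<Gamma> (u x)) - (LINT x|M. f x * u x)"
      by (simp add: energy_def Q_def)
    then show "K * S + Q / (2 * p) \<le> energy u g + (l * C1 + l * C2 / (2 * p))"
      using 1 2 3 4 unfolding k_def distrib_right right_diff_distrib by linarith
  qed
qed

lemma pair_lincomb: "pair u g \<Longrightarrow> pair w h \<Longrightarrow> pair (\<lambda>x. s * u x + t * w x) (\<lambda>x. s * g x + t * h x)"
  by (rule sobolev_pair_lincomb[OF p])

lemma pair_midpoint: "pair u g \<Longrightarrow> pair w h \<Longrightarrow> pair (\<lambda>x. (u x + w x) / 2) (\<lambda>x. (g x + h x) / 2)"
  using pair_lincomb[of u g w h "1/2" "1/2"] by (simp add: add_divide_distrib)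

lemma midpoint_gap_integrable:
  assumes "pair u g" "pair w h"
  shows "integrable M (\<lambda>x. midpoint_gap p (g x) (h x))"
  unfolding midpoint_gap_def
  using pair_Lp[OF assms(1)] pair_Lp[OF assms(2)] pair_Lp[OF pair_midpoint[OF assms]] by simp

text \<open>The power term loses exactly the integral of the gap, the \<Gamma> term is midpoint
  convex and the term with f is linear. Keeping the gap instead of discarding it is what later
  controls the derivatives.\<close>

lemma energy_midpoint:
  assumes u: "pair u g" and w: "pair w h"
  shows "energy (\<lambda>x. (u x + w x) / 2) (\<lambda>x. (g x + h x) / 2) + (LINT x|M. midpoint_gap p (g x) (h x))
    \<le> (energy u g + energy w h) / 2"
proof -
  note m = pair_midpoint[OF u w]
  have 1: "(LINT x|M. midpoint_gap p (g x) (h x)) =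
      ((LINT x|M. \<bar>g x\<bar> powr p / p) + (LINT x|M. \<bar>h x\<bar> powr p / p)) / 2
      - (LINT x|M. \<bar>(g x + h x) / 2\<bar> powr p / p)"
    unfolding midpoint_gap_def using pair_Lp[OF u] pair_Lp[OF w] pair_Lp[OF m] by simp
  have "(LINT x|M. \<Gamma> ((u x + w x) / 2)) \<le> (LINT x|M. (\<Gamma> (u x) + \<Gamma> (w x)) / 2)"
    using subgradient_midpoint[of \<Gamma> \<gamma>, OF \<Gamma>_sub] integrable_comp[OF \<Gamma>_cont] pair_cont[OF u]
      pair_cont[OF w] pair_cont[OF m] by (intro integral_mono) auto
  also have "\<dots> = ((LINT x|M. \<Gamma> (u x)) + (LINT x|M. \<Gamma> (w x))) / 2"
    using integrable_comp[OF \<Gamma>_cont] pair_cont[OF u] pair_cont[OF w] by simp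
  finally have 2: "(LINT x|M. \<Gamma> ((u x + w x) / 2)) \<le> ((LINT x|M. \<Gamma> (u x)) + (LINT x|M. \<Gamma> (w x))) / 2" .
  have "(LINT x|M. f x * ((u x + w x) / 2)) = (LINT x|M. (f x * u x) / 2 + (f x * w x) / 2)"
    by (intro Bochner_Integration.integral_cong) (auto simp: algebra_simps add_divide_distrib)
  also have "\<dots> = (LINT x|M. f x * u x) / 2 + (LINT x|M. f x * w x) / 2"
    using integrable_mult_cont[OF f pair_cont[OF u]] integrable_mult_cont[OF f pair_cont[OF w]]
    by simp
  finally have "(LINT x|M. f x * ((u x + w x) / 2)) = (LINT x|M. f x * u x) / 2 + (LINT x|M. f x * w x) / 2" .
  note 3 = this
  have "R + Y - Z + G \<le> ((P + A - C) + (Q + B - D)) / 2"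
    if "G = (P + Q) / 2 - R" "Y \<le> (A + B) / 2" "Z = C / 2 + D / 2" for A B C D P Q R Y Z G :: real
    using that by argo
  then show ?thesis using 1 2 3 unfolding energy_def by blast
qed

text \<open>The directional derivative of the energy at \<open>(u, g)\<close> in direction \<open>(\<phi>, h)\<close>.\<close>

definition slope :: "(real \<Rightarrow> real) \<Rightarrow> (real \<Rightarrow> real) \<Rightarrow> (real \<Rightarrow> real) \<Rightarrow> (real \<Rightarrow> real) \<Rightarrow> real" where
  "slope u g \<phi> h = (LINT x|M. p_flux p (g x) * h x) + (LINT x|M. \<gamma> (u x) * \<phi> x) - (LINT x|M. f x * \<phi> x)"

lemma flux_integrable:
  assumes "pair u g" "pair w h"
  shows "integrable M (\<lambda>x. p_flux p (g x) * h x)"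
proof (rule Bochner_Integration.integrable_bound)
  show "integrable M (\<lambda>x. (1 - 1/p) * \<bar>g x\<bar> powr p + \<bar>h x\<bar> powr p / p)"
    using assms pair_Lp by simp
  show "(\<lambda>x. p_flux p (g x) * h x) \<in> borel_measurable M"
    using pair_meas[OF assms(1)] pair_meas[OF assms(2)] by (simp add: p_flux_def)
  show "AE x in M. norm (p_flux p (g x) * h x) \<le> norm ((1 - 1/p) * \<bar>g x\<bar> powr p + \<bar>h x\<bar> powr p / p)"
    using p_flux_mult_le[OF p] by (intro AE_I2) (metis abs_ge_self order.trans real_norm_def)
qed

text \<open>The subgradient inequalities are taken at the moved point, not at u, and so bound the
  increment from above. For a minimizer the increment plus the load term is nonnegative, which gives
  information on the slope near u without differentiating under the integral.\<close>

lemma energy_slope: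
  assumes u: "pair u g" and \<phi>: "pair \<phi> h"
  shows "energy (\<lambda>x. u x + t * \<phi> x) (\<lambda>x. g x + t * h x) - energy u g
    \<le> t * slope (\<lambda>x. u x + t * \<phi> x) (\<lambda>x. g x + t * h x) \<phi> h"
proof -
  define U G where "U = (\<lambda>x. u x + t * \<phi> x)" and "G = (\<lambda>x. g x + t * h x)"
  have w: "pair U G" using pair_lincomb[OF u \<phi>, of 1 t] by (simp add: U_def G_def)
  have "(LINT x|M. \<bar>G x\<bar> powr p / p) - (LINT x|M. \<bar>g x\<bar> powr p / p)
      = (LINT x|M. \<bar>G x\<bar> powr p / p - \<bar>g x\<bar> powr p / p)"
    using pair_Lp[OF u] pair_Lp[OF w] by simp
  also have "\<dots> \<le> (LINT x|M. t * (p_flux p (G x) * h x))"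
  proof (rule integral_mono)
    show "integrable M (\<lambda>x. \<bar>G x\<bar> powr p / p - \<bar>g x\<bar> powr p / p)"
      using pair_Lp[OF u] pair_Lp[OF w] by simp
    show "integrable M (\<lambda>x. t * (p_flux p (G x) * h x))" using flux_integrable[OF w \<phi>] by simp
    show "\<bar>G x\<bar> powr p / p - \<bar>g x\<bar> powr p / p \<le> t * (p_flux p (G x) * h x)" for x
      using powr_subgradient[OF p, of "G x" "g x"] by (simp add: G_def mult_ac)
  qed
  finally have 1: "(LINT x|M. \<bar>G x\<bar> powr p / p) - (LINT x|M. \<bar>g x\<bar> powr p / p)
    \<le> t * (LINT x|M. p_flux p (G x) * h x)" by simp
  have i: "integrable M (\<lambda>x. \<gamma> (U x) * \<phi> x)"
    by (intro integrable_mult_cont integrable_comp \<gamma>_cont pair_cont[OF w] pair_cont[OF \<phi>])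
  have "(LINT x|M. \<Gamma> (U x)) - (LINT x|M. \<Gamma> (u x)) = (LINT x|M. \<Gamma> (U x) - \<Gamma> (u x))"
    using integrable_comp[OF \<Gamma>_cont] pair_cont[OF u] pair_cont[OF w] by simp
  also have "\<dots> \<le> (LINT x|M. t * (\<gamma> (U x) * \<phi> x))"
  proof (rule integral_mono)
    show "integrable M (\<lambda>x. \<Gamma> (U x) - \<Gamma> (u x))"
      using integrable_comp[OF \<Gamma>_cont] pair_cont[OF u] pair_cont[OF w] by simp
    show "integrable M (\<lambda>x. t * (\<gamma> (U x) * \<phi> x))" using i by simp
    show "\<Gamma> (U x) - \<Gamma> (u x) \<le> t * (\<gamma> (U x) * \<phi> x)" for x
      using \<Gamma>_sub[of "U x" "u x"] by (simp add: U_def mult_ac)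
  qed
  finally have 2: "(LINT x|M. \<Gamma> (U x)) - (LINT x|M. \<Gamma> (u x)) \<le> t * (LINT x|M. \<gamma> (U x) * \<phi> x)" by simp
  have "(LINT x|M. f x * U x) = (LINT x|M. f x * u x + t * (f x * \<phi> x))"
    by (intro Bochner_Integration.integral_cong) (auto simp: U_def algebra_simps)
  also have "\<dots> = (LINT x|M. f x * u x) + t * (LINT x|M. f x * \<phi> x)"
    using integrable_mult_cont[OF f pair_cont[OF u]] integrable_mult_cont[OF f pair_cont[OF \<phi>]] by simp
  finally have 3: "(LINT x|M. f x * U x) = (LINT x|M. f x * u x) + t * (LINT x|M. f x * \<phi> x)" .
  have "energy U G - energy u g \<le> t * slope U G \<phi> h"
    using 1 2 3 unfolding energy_def slope_def by (simp add: algebra_simps)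
  then show ?thesis by (simp add: U_def G_def)
qed

text \<open>For |t| \<le> 1 Young's inequality bounds the flux term by p-th powers of g and h alone,
  and the arguments of \<gamma> stay in a fixed compact interval, where \<gamma> is bounded; both
  give majorants independent of n.\<close>

lemma slope_tendsto:
  assumes u: "pair u g" and \<phi>: "pair \<phi> h" and t: "t \<longlonglongrightarrow> 0" "\<And>n. \<bar>t n\<bar> \<le> 1"
  shows "(\<lambda>n. slope (\<lambda>x. u x + t n * \<phi> x) (\<lambda>x. g x + t n * h x) \<phi> h) \<longlonglongrightarrow> slope u g \<phi> h"
proof -
  have w: "pair (\<lambda>x. u x + t n * \<phi> x) (\<lambda>x. g x + t n * h x)" for n
    using pair_lincomb[OF u \<phi>, of 1 "t n"] by simp
  have lim: "(\<lambda>n. a + t n * b) \<longlonglongrightarrow> a" for a b :: real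
    using tendsto_add[OF tendsto_const tendsto_mult[OF t(1) tendsto_const], of a b] by simp
  have limc: "(\<lambda>n. c (a + t n * b)) \<longlonglongrightarrow> c a" if "continuous_on UNIV c" for a b and c :: "real \<Rightarrow> real"
    using that lim by (auto simp: continuous_on_eq_continuous_at intro: isCont_tendsto_compose)
  have 1: "(\<lambda>n. LINT x|M. p_flux p (g x + t n * h x) * h x) \<longlonglongrightarrow> (LINT x|M. p_flux p (g x) * h x)"
  proof (rule integral_dominated_convergence)
    show "integrable M (\<lambda>x. (1 - 1/p) * (2 powr p * (\<bar>g x\<bar> powr p + \<bar>h x\<bar> powr p)) + \<bar>h x\<bar> powr p / p)"
      using pair_Lp[OF u] pair_Lp[OF \<phi>] by simp
    show "AE x in M. (\<lambda>n. p_flux p (g x + t n * h x) * h x) \<longlonglongrightarrow> p_flux p (g x) * h x"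
      by (intro AE_I2 tendsto_intros limc continuous_p_flux p)
    show "AE x in M. norm (p_flux p (g x + t n * h x) * h x)
        \<le> (1 - 1/p) * (2 powr p * (\<bar>g x\<bar> powr p + \<bar>h x\<bar> powr p)) + \<bar>h x\<bar> powr p / p" for n
    proof (rule AE_I2)
      fix x
      have "\<bar>g x + t n * h x\<bar> powr p \<le> 2 powr p * (\<bar>g x\<bar> powr p + \<bar>t n * h x\<bar> powr p)"
        using p by (intro powr_abs_le_sum) auto
      also have "\<bar>t n * h x\<bar> powr p \<le> \<bar>h x\<bar> powr p"
        using t(2)[of n] p by (intro powr_mono2) (auto simp: abs_mult mult_left_le_one_le)
      finally have "\<bar>g x + t n * h x\<bar> powr p \<le> 2 powr p * (\<bar>g x\<bar> powr p + \<bar>h x\<bar> powr p)"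
        by simp
      then have "(1 - 1/p) * \<bar>g x + t n * h x\<bar> powr p \<le> (1 - 1/p) * (2 powr p * (\<bar>g x\<bar> powr p + \<bar>h x\<bar> powr p))"
        using p by (intro mult_left_mono) auto
      then show "norm (p_flux p (g x + t n * h x) * h x)
        \<le> (1 - 1/p) * (2 powr p * (\<bar>g x\<bar> powr p + \<bar>h x\<bar> powr p)) + \<bar>h x\<bar> powr p / p"
        using p_flux_mult_le[OF p, of "g x + t n * h x" "h x"] by simp
    qed
  qed (use flux_integrable[OF w \<phi>] flux_integrable[OF u \<phi>] in auto)
  have 2: "(\<lambda>n. LINT x|M. \<gamma> (u x + t n * \<phi> x) * \<phi> x) \<longlonglongrightarrow> (LINT x|M. \<gamma> (u x) * \<phi> x)"
  proof -
    define R where "R = sup_abs l u + sup_abs l \<phi>"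
    obtain B where B: "\<And>s. s \<in> {-R..R} \<Longrightarrow> \<bar>\<gamma> s\<bar> \<le> B"
      using continuous_imp_bounded_Icc[OF \<gamma>_cont] by metis
    have i: "integrable M (\<lambda>x. \<gamma> (U x) * \<phi> x)" if "pair U G" for U G
      by (intro integrable_mult_cont integrable_comp \<gamma>_cont pair_cont[OF that] pair_cont[OF \<phi>])
    show ?thesis
    proof (rule integral_dominated_convergence)
      show "integrable M (\<lambda>x. B * \<bar>\<phi> x\<bar>)" using integrable_cont[OF pair_cont[OF \<phi>]] by simp
      show "AE x in M. (\<lambda>n. \<gamma> (u x + t n * \<phi> x) * \<phi> x) \<longlonglongrightarrow> \<gamma> (u x) * \<phi> x"
        by (intro AE_I2 tendsto_intros limc \<gamma>_cont)
      show "AE x in M. norm (\<gamma> (u x + t n * \<phi> x) * \<phi> x) \<le> B * \<bar>\<phi> x\<bar>" for n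
      proof (rule AE_I2)
        fix x assume "x \<in> space M"
        then have x: "x \<in> {0..l}" by auto
        have "\<bar>t n * \<phi> x\<bar> \<le> \<bar>\<phi> x\<bar>" using t(2)[of n] by (simp add: abs_mult mult_left_le_one_le)
        then have "\<bar>u x + t n * \<phi> x\<bar> \<le> R"
          using sup_abs(2)[OF l pair_cont[OF u] x] sup_abs(2)[OF l pair_cont[OF \<phi>] x]
          unfolding R_def by linarith
        then have "\<bar>\<gamma> (u x + t n * \<phi> x)\<bar> \<le> B" by (intro B) auto
        then show "norm (\<gamma> (u x + t n * \<phi> x) * \<phi> x) \<le> B * \<bar>\<phi> x\<bar>"
          by (simp add: abs_mult mult_right_mono)
      qed
    qed (use i[OF w] i[OF u] in auto)
  qed
  show ?thesis unfolding slope_def by (intro tendsto_intros 1 2)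
qed

text \<open>The constant C depends on \<epsilon> but not on the pairs. Along a family with bounded
  p-energies \<epsilon> is fixed first to make the first term small, and then small gaps make the
  second one small.\<close>

lemma L1_dist_le_gap:
  assumes "0 < \<epsilon>"
  obtains C where "0 \<le> C" "\<And>u g w h. pair u g \<Longrightarrow> pair w h \<Longrightarrow>
    (LINT x|M. \<bar>g x - h x\<bar>) \<le> \<epsilon> * (l + (LINT x|M. \<bar>g x\<bar> powr p) + (LINT x|M. \<bar>h x\<bar> powr p))
      + C * (LINT x|M. midpoint_gap p (g x) (h x))"
proof -
  obtain C where C: "0 \<le> C"
    "\<And>a b. \<bar>a - b\<bar> \<le> \<epsilon> * (1 + \<bar>a\<bar> powr p + \<bar>b\<bar> powr p) + C * midpoint_gap p a b"
    using dist_le_midpoint_gap[OF p assms] by metis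
  show ?thesis
  proof (rule that[OF C(1)])
    fix u g w h assume u: "pair u g" and w: "pair w h"
    note i = pair_Lp[OF u] pair_Lp[OF w] midpoint_gap_integrable[OF u w]
    have "(LINT x|M. \<bar>g x - h x\<bar>)
        \<le> (LINT x|M. \<epsilon> * (1 + \<bar>g x\<bar> powr p + \<bar>h x\<bar> powr p) + C * midpoint_gap p (g x) (h x))"
      using C(2) i pair_int[OF u] pair_int[OF w] by (intro integral_mono) auto
    also have "\<dots> = \<epsilon> * (l + (LINT x|M. \<bar>g x\<bar> powr p) + (LINT x|M. \<bar>h x\<bar> powr p))
      + C * (LINT x|M. midpoint_gap p (g x) (h x))"
      using i by (simp add: measure_M)
    finally show "(LINT x|M. \<bar>g x - h x\<bar>) \<le> \<epsilon> * (l + (LINT x|M. \<bar>g x\<bar> powr p) + (LINT x|M. \<bar>h x\<bar> powr p))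
      + C * (LINT x|M. midpoint_gap p (g x) (h x))" .
  qed
qed

text \<open>The limit is rebuilt as the primitive of the limiting derivative with the limiting value
  at 0. The \<Gamma> and f terms converge by domination; the p-energy satisfies only the Fatou
  inequality, so \<open>e\<close> may exceed the energy of the limit.\<close>

lemma energy_limit:
  assumes u: "\<And>n. pair (u n) (g n)" and fast: "\<And>n. (LINT x|M. \<bar>g (Suc n) x - g n x\<bar>) \<le> (1/2)^n"
    and c: "(\<lambda>n. u n 0) \<longlonglongrightarrow> c" and a: "(\<lambda>n. LINT x|M. \<bar>g n x\<bar> powr p) \<longlonglongrightarrow> a"
    and R: "\<And>n. sup_abs l (u n) \<le> R"
  obtains w h e where "pair w h" "\<And>x. x \<in> {0..l} \<Longrightarrow> (\<lambda>n. u n x) \<longlonglongrightarrow> w x"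
    "(\<lambda>n. energy (u n) (g n)) \<longlonglongrightarrow> e" "energy w h \<le> e"
proof -
  obtain h where h: "integrable M h" "AE x in M. (\<lambda>n. g n x) \<longlonglongrightarrow> h x"
    "(\<lambda>n. LINT x|M. \<bar>g n x - h x\<bar>) \<longlonglongrightarrow> 0"
    by (rule L1_complete[OF pair_int[OF u] fast])
  define w where "w = (\<lambda>x. c + integral {0..x} h)"
  have hm[measurable]: "h \<in> borel_measurable M" using h(1) by simp
  have Fatou: "integrable M (\<lambda>x. \<bar>h x\<bar> powr p)" "(LINT x|M. \<bar>h x\<bar> powr p) \<le> a"
  proof -
    have m: "(\<lambda>x. \<bar>h x\<bar> powr p) \<in> borel_measurable M" by measurable
    have l: "AE x in M. (\<lambda>n. \<bar>g n x\<bar> powr p) \<longlonglongrightarrow> \<bar>h x\<bar> powr p"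
      using h(2) by eventually_elim (use p in \<open>auto intro!: tendsto_powr' tendsto_intros\<close>)
    show "integrable M (\<lambda>x. \<bar>h x\<bar> powr p)" "(LINT x|M. \<bar>h x\<bar> powr p) \<le> a"
      using integral_Fatou[OF pair_Lp[OF u] _ m l _ a] by auto
  qed
  have w: "pair w h"
    unfolding sobolev_pair_def Lp_on_def using Fatou by (auto simp: w_def)
  have lim: "(\<lambda>n. u n x) \<longlonglongrightarrow> w x" if x: "x \<in> {0..l}" for x
  proof -
    have "\<bar>u n x - w x\<bar> \<le> \<bar>u n 0 - c\<bar> + (LINT x|M. \<bar>g n x - h x\<bar>)" for n
    proof -
      have d: "pair (\<lambda>x. u n x - w x) (\<lambda>x. g n x - h x)"
        using pair_lincomb[OF u[of n] w, of 1 "-1"] by simp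
      show ?thesis using pair_osc[OF d x, of 0] l by (simp add: w_def)
    qed
    moreover have "(\<lambda>n. \<bar>u n 0 - c\<bar> + (LINT x|M. \<bar>g n x - h x\<bar>)) \<longlonglongrightarrow> 0"
      using tendsto_add[OF tendsto_rabs_zero[OF LIM_zero[OF c]] h(3)] by simp
    ultimately have "(\<lambda>n. u n x - w x) \<longlonglongrightarrow> 0"
      by (intro Lim_null_comparison[of "\<lambda>n. u n x - w x"]) auto
    then show ?thesis by (rule LIM_zero_cancel)
  qed
  have bound: "\<bar>u n x\<bar> \<le> R" if "x \<in> space M" for n x
    using sup_abs(2)[OF l pair_cont[OF u[of n]], of x] R[of n] that by auto
  have 1: "(\<lambda>n. LINT x|M. \<Gamma> (u n x)) \<longlonglongrightarrow> (LINT x|M. \<Gamma> (w x))"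
  proof -
    obtain B where B: "\<And>s. s \<in> {-R..R} \<Longrightarrow> \<bar>\<Gamma> s\<bar> \<le> B"
      using continuous_imp_bounded_Icc[OF \<Gamma>_cont] by metis
    show ?thesis
    proof (rule integral_dominated_convergence)
      show "integrable M (\<lambda>_. B)" by simp
      show "AE x in M. (\<lambda>n. \<Gamma> (u n x)) \<longlonglongrightarrow> \<Gamma> (w x)"
        using \<Gamma>_cont lim by (intro AE_I2 isCont_tendsto_compose[of _ \<Gamma>])
          (auto simp: continuous_on_eq_continuous_at)
      show "AE x in M. norm (\<Gamma> (u n x)) \<le> B" for n
      proof (rule AE_I2)
        fix x assume "x \<in> space M"
        then have "u n x \<in> {-R..R}" using bound[of x n] by (auto simp: abs_le_iff)
        then show "norm (\<Gamma> (u n x)) \<le> B" using B by simp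
      qed
    qed (use integrable_comp[OF \<Gamma>_cont] pair_cont[OF u] pair_cont[OF w] in auto)
  qed
  have 2: "(\<lambda>n. LINT x|M. f x * u n x) \<longlonglongrightarrow> (LINT x|M. f x * w x)"
  proof (rule integral_dominated_convergence)
    show "integrable M (\<lambda>x. \<bar>f x\<bar> * R)" using f by simp
    show "AE x in M. (\<lambda>n. f x * u n x) \<longlonglongrightarrow> f x * w x"
      using lim by (intro AE_I2 tendsto_intros) auto
    show "AE x in M. norm (f x * u n x) \<le> \<bar>f x\<bar> * R" for n
      using bound by (intro AE_I2) (auto simp: abs_mult intro!: mult_left_mono)
  qed (use integrable_mult_cont[OF f] pair_cont[OF u] pair_cont[OF w] in auto)
  have "(\<lambda>n. energy (u n) (g n)) \<longlonglongrightarrow> a / p + (LINT x|M. \<Gamma> (w x)) - (LINT x|M. f x * w x)"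
    unfolding energy_def integral_divide_zero using p by (intro tendsto_intros 1 2 a) auto
  moreover have "energy w h \<le> a / p + (LINT x|M. \<Gamma> (w x)) - (LINT x|M. f x * w x)"
    unfolding energy_def integral_divide_zero using p Fatou(2) by (simp add: divide_right_mono)
  ultimately show ?thesis using that[OF w lim] by blast
qed

end

text \<open>An antiderivative of a monotone function satisfies the subgradient inequality by the
  mean value theorem, and its supporting lines have every real slope because \<gamma> is
  onto.\<close>

lemma convex_primitive_exists:
  fixes \<gamma> :: "real \<Rightarrow> real"
  assumes c: "continuous_on UNIV \<gamma>" and m: "strict_mono \<gamma>" and r: "range \<gamma> = UNIV"
  obtains \<Gamma> where "continuous_on UNIV \<Gamma>" "\<And>a b. \<Gamma> b - \<Gamma> a \<le> \<gamma> b * (b - a)"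
    "\<And>K. \<exists>C. \<forall>s. K * \<bar>s\<bar> \<le> \<Gamma> s + C"
proof -
  have "isCont \<gamma> x" for x using c by (simp add: continuous_on_eq_continuous_at)
  then obtain F where F: "\<And>x. (F has_real_derivative \<gamma> x) (at x)"
    using einterval_antiderivative[of "-\<infinity>" \<infinity> \<gamma>]
    by (auto simp: has_real_derivative_iff_has_vector_derivative)
  have mono: "\<gamma> a \<le> \<gamma> b" if "a \<le> b" for a b using m that by (simp add: strict_mono_less_eq)
  have sub: "F b - F a \<le> \<gamma> b * (b - a)" for a b
  proof (cases a b rule: linorder_cases)
    case less
    then obtain z where z: "a < z" "z < b" "F b - F a = (b - a) * \<gamma> z" using MVT2[of a b F \<gamma>] F by blast
    have "(b - a) * \<gamma> z \<le> (b - a) * \<gamma> b" using z less by (intro mult_left_mono mono) auto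
    then show ?thesis using z by (simp add: mult.commute)
  next
    case greater
    then obtain z where z: "b < z" "z < a" "F a - F b = (a - b) * \<gamma> z" using MVT2[of b a F \<gamma>] F by blast
    have "(a - b) * \<gamma> b \<le> (a - b) * \<gamma> z" using z greater by (intro mult_left_mono mono) auto
    then show ?thesis using z by (simp add: algebra_simps)
  qed simp
  show ?thesis
  proof
    show "continuous_on UNIV F" using F by (intro continuous_at_imp_continuous_on) (auto intro: DERIV_isCont)
    show "F b - F a \<le> \<gamma> b * (b - a)" for a b by (rule sub)
    fix K
    \<comment> \<open>The supporting lines at s1 and s2 have slopes K and -K. One bounds
      \<open>F\<close> from below for s \<ge> 0, the other for s < 0.\<close>
    obtain s1 s2 where s: "\<gamma> s1 = K" "\<gamma> s2 = - K" using r by (metis rangeE UNIV_I)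
    have "K * \<bar>s\<bar> \<le> F s + (\<bar>K * s1 - F s1\<bar> + \<bar>- (K * s2) - F s2\<bar>)" for s
      using sub[of s1 s] sub[of s2 s] s by (cases "0 \<le> s") (auto simp: algebra_simps)
    then show "\<exists>C. \<forall>s. K * \<bar>s\<bar> \<le> F s + C" by blast
  qed
qed

context edge_problem
begin

lemma pair_unique:
  assumes "pair u g" "pair u g'"
  shows "AE x in M. g x = g' x"
  using sobolev_pair_weak_deriv(2)[OF p l assms(1)] sobolev_pair_weak_deriv(2)[OF p l assms(2)]
  by eventually_elim simp

text \<open>The slope does not notice which derivative accompanies a function. This reconciles the
  derivative built as a limit with the one selected by \<open>weak_deriv\<close>.\<close>

lemma slope_cong:
  assumes u: "pair u g" "pair u g'" and \<phi>: "pair \<phi> h" "pair \<phi> h'"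
  shows "slope u g \<phi> h = slope u g' \<phi> h'"
proof -
  have "(LINT x|M. p_flux p (g x) * h x) = (LINT x|M. p_flux p (g' x) * h' x)"
  proof (rule integral_cong_AE)
    show "AE x in M. p_flux p (g x) * h x = p_flux p (g' x) * h' x"
      using pair_unique[OF u] pair_unique[OF \<phi>] by eventually_elim simp
  qed (use flux_integrable[OF u(1) \<phi>(1)] flux_integrable[OF u(2) \<phi>(2)] in auto)
  then show ?thesis by (simp add: slope_def)
qed

lemma slope_minus: "slope u g (\<lambda>x. - \<phi> x) (\<lambda>x. - h x) = - slope u g \<phi> h"
  by (simp add: slope_def)

text \<open>In the difference of the two slopes the f terms cancel and the flux term is nonnegative
  by monotonicity of \<open>p_flux p\<close>; dropping it leaves the \<gamma> term.\<close>

lemma slope_monotone: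
  assumes u: "pair u g" and w: "pair w h"
  defines "k \<equiv> \<lambda>x. (\<gamma> (u x) - \<gamma> (w x)) * (u x - w x)"
  shows "integrable M k" "\<And>x. 0 \<le> k x"
    "(LINT x|M. k x) \<le> slope u g (\<lambda>x. u x - w x) (\<lambda>x. g x - h x)
       - slope w h (\<lambda>x. u x - w x) (\<lambda>x. g x - h x)"
proof -
  have d: "pair (\<lambda>x. u x - w x) (\<lambda>x. g x - h x)"
    using pair_lincomb[OF u w, of 1 "-1"] by simp
  have i: "integrable M (\<lambda>x. \<gamma> (u x) * (u x - w x))" "integrable M (\<lambda>x. \<gamma> (w x) * (u x - w x))"
    by (intro integrable_mult_cont integrable_comp \<gamma>_cont pair_cont[OF u] pair_cont[OF w] pair_cont[OF d])+
  note j = flux_integrable[OF u d] flux_integrable[OF w d]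
  show "integrable M k" unfolding k_def left_diff_distrib
    using Bochner_Integration.integrable_diff[OF i] by simp
  have mono: "0 \<le> (c a - c b) * (a - b)" if "strict_mono c" for c :: "real \<Rightarrow> real" and a b
  proof (cases "a \<le> b")
    case True
    then show ?thesis using strict_mono_less_eq[OF that, of a b] by (intro mult_nonpos_nonpos) auto
  next
    case False
    then show ?thesis using strict_mono_less_eq[OF that, of b a] by (intro mult_nonneg_nonneg) auto
  qed
  show "0 \<le> k x" for x unfolding k_def by (rule mono[OF \<gamma>_mono])
  have "(LINT x|M. k x) = (LINT x|M. \<gamma> (u x) * (u x - w x)) - (LINT x|M. \<gamma> (w x) * (u x - w x))"
    unfolding k_def left_diff_distrib[of "\<gamma> (u _)"] by (rule Bochner_Integration.integral_diff[OF i])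
  moreover have "0 \<le> (LINT x|M. (p_flux p (g x) - p_flux p (h x)) * (g x - h x))"
    using mono[OF strict_mono_p_flux[OF p]] by (intro integral_nonneg_AE) auto
  moreover have "(LINT x|M. (p_flux p (g x) - p_flux p (h x)) * (g x - h x))
      = (LINT x|M. p_flux p (g x) * (g x - h x)) - (LINT x|M. p_flux p (h x) * (g x - h x))"
    unfolding left_diff_distrib[of "p_flux p (g _)"] by (rule Bochner_Integration.integral_diff[OF j])
  ultimately show "(LINT x|M. k x) \<le> slope u g (\<lambda>x. u x - w x) (\<lambda>x. g x - h x)
       - slope w h (\<lambda>x. u x - w x) (\<lambda>x. g x - h x)"
    unfolding slope_def by linarith
qed

end

section \<open>Common and fast subsequences\<close>

lemma finite_convergent_subsequence:
  fixes x :: "'i \<Rightarrow> nat \<Rightarrow> real"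
  assumes "finite A" "\<And>a. a \<in> A \<Longrightarrow> bounded (range (x a))"
  shows "\<exists>r. strict_mono r \<and> (\<forall>a\<in>A. convergent (\<lambda>n. x a (r n)))"
  using assms
proof (induction A rule: finite_induct)
  case empty
  show ?case by (intro exI[of _ id]) (auto simp: strict_mono_def)
next
  case (insert a A)
  then obtain r where r: "strict_mono r" "\<And>b. b \<in> A \<Longrightarrow> convergent (\<lambda>n. x b (r n))" by auto
  have "bounded (range (x a \<circ> r))"
    using insert.prems[of a] by (rule bounded_subset) auto
  then obtain c s where s: "strict_mono s" "((x a \<circ> r) \<circ> s) \<longlonglongrightarrow> c"
    using bounded_imp_convergent_subsequence[of "x a \<circ> r"] by blast
  have "convergent (\<lambda>n. x b ((r \<circ> s) n))" if "b \<in> insert a A" for b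
  proof (cases "b = a")
    case True
    then show ?thesis using s(2) by (auto simp: convergent_def o_def)
  next
    case False
    then have "convergent (\<lambda>n. x b (r n))" using that r(2) by auto
    then obtain c' where "(\<lambda>n. x b (r n)) \<longlonglongrightarrow> c'" by (auto simp: convergent_def)
    then have "((\<lambda>n. x b (r n)) \<circ> s) \<longlonglongrightarrow> c'" using s(1) by (rule LIMSEQ_subseq_LIMSEQ)
    then show ?thesis by (auto simp: convergent_def o_def)
  qed
  then show ?case using strict_mono_o[OF r(1) s(1)] by blast
qed

text \<open>Turns the thresholds of a Cauchy condition into indices along which consecutive
  distances are at most (1/2)^n.\<close>

lemma strict_mono_above:
  fixes N :: "nat \<Rightarrow> nat"
  shows "\<exists>r. strict_mono r \<and> (\<forall>n. N n \<le> r n)"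
proof -
  have "\<exists>r. \<forall>n. N n \<le> r n \<and> r n < r (Suc n)"
  proof (rule dependent_nat_choice)
    show "\<exists>x. N 0 \<le> x" by blast
    show "\<exists>y. N (Suc n) \<le> y \<and> x < y" for x n
      by (rule exI[of _ "max (N (Suc n)) (Suc x)"]) auto
  qed
  then show ?thesis by (metis strict_mono_Suc_iff)
qed

section \<open>Minimizing the energy of the network\<close>

locale network = compact_metric_graph G len
  for G :: "'v pair_pre_digraph" and len :: "'v \<times> 'v \<Rightarrow> real" +
  fixes p :: "'v \<times> 'v \<Rightarrow> real" and \<gamma> \<Gamma> :: "'v \<times> 'v \<Rightarrow> real \<Rightarrow> real"
    and f :: "'v graph_fun" and \<omega> :: "'v \<Rightarrow> real"
  assumes edge: "e \<in> parcs G \<Longrightarrow> edge_problem (p e) (len e) (\<gamma> e) (\<Gamma> e) (f e)"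
begin

declare pair_finite_arcs [simp] pair_finite_verts [simp]

definition matching :: "'v graph_fun \<Rightarrow> bool" where
  "matching u \<longleftrightarrow> (\<forall>z\<in>pverts G. \<forall>e\<in>incident_edges G z. \<forall>e'\<in>incident_edges G z.
     end_value len u e z = end_value len u e' z)"

definition admissible :: "'v graph_fun \<Rightarrow> 'v graph_fun \<Rightarrow> bool" where
  "admissible u g \<longleftrightarrow> (\<forall>e\<in>parcs G. sobolev_pair (p e) (len e) (u e) (g e)) \<and> matching u"

text \<open>Reading the value off one fixed edge, rather than as the common value, makes the trace
  linear in u and continuous under pointwise convergence without any matching condition. On matching
  functions it equals \<open>vertex_value\<close>.\<close>

definition trace :: "'v graph_fun \<Rightarrow> 'v \<Rightarrow> real" where
  "trace u z = (if incident_edges G z = {} then 0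
     else end_value len u (SOME e. e \<in> incident_edges G z) z)"

definition load :: "'v graph_fun \<Rightarrow> real" where
  "load u = (\<Sum>z\<in>pverts G. \<omega> z * trace u z)"

abbreviation "edge_energy e \<equiv> edge_problem.energy (p e) (len e) (\<Gamma> e) (f e)"
abbreviation "edge_slope e \<equiv> edge_problem.slope (p e) (len e) (\<gamma> e) (f e)"

definition energy :: "'v graph_fun \<Rightarrow> 'v graph_fun \<Rightarrow> real" where
  "energy u g = (\<Sum>e\<in>parcs G. edge_energy e (u e) (g e)) - load u"

lemma admissibleD:
  assumes "admissible u g"
  shows "e \<in> parcs G \<Longrightarrow> sobolev_pair (p e) (len e) (u e) (g e)" and "matching u"
  using assms by (auto simp: admissible_def)

lemma some_incident:
  "incident_edges G z \<noteq> {} \<Longrightarrow> (SOME e. e \<in> incident_edges G z) \<in> incident_edges G z"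
  by (rule someI_ex) blast

lemma some_incident_edge:
  "incident_edges G z \<noteq> {} \<Longrightarrow> (SOME e. e \<in> incident_edges G z) \<in> parcs G"
  using some_incident[of z] by (simp add: incident_edges_def)

lemma end_value_lincomb:
  "end_value len (\<lambda>e x. s * u e x + t * w e x) e z = s * end_value len u e z + t * end_value len w e z"
  by (simp add: end_value_def)

lemma load_lincomb: "load (\<lambda>e x. s * u e x + t * w e x) = s * load u + t * load w"
proof -
  have "trace (\<lambda>e x. s * u e x + t * w e x) z = s * trace u z + t * trace w z" for z
    by (simp add: trace_def end_value_lincomb)
  then show ?thesis
    unfolding load_def sum_distrib_left sum.distrib[symmetric]
    by (intro sum.cong) (auto simp: algebra_simps)
qed

lemma admissible_lincomb:
  assumes u: "admissible u g" and w: "admissible w h"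
  shows "admissible (\<lambda>e x. s * u e x + t * w e x) (\<lambda>e x. s * g e x + t * h e x)"
  unfolding admissible_def
proof
  show "\<forall>e\<in>parcs G. sobolev_pair (p e) (len e) (\<lambda>x. s * u e x + t * w e x) (\<lambda>x. s * g e x + t * h e x)"
    by (intro ballI edge_problem.pair_lincomb[OF edge] admissibleD(1)[OF u] admissibleD(1)[OF w])
  show "matching (\<lambda>e x. s * u e x + t * w e x)"
    unfolding matching_def end_value_lincomb
  proof (intro ballI)
    fix z e e' assume "z \<in> pverts G" "e \<in> incident_edges G z" "e' \<in> incident_edges G z"
    then have "end_value len u e z = end_value len u e' z" "end_value len w e z = end_value len w e' z"
      using admissibleD(2)[OF u] admissibleD(2)[OF w] unfolding matching_def by blast+
    then show "s * end_value len u e z + t * end_value len w e z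
      = s * end_value len u e' z + t * end_value len w e' z" by simp
  qed
qed

lemma edge_cont: "admissible u g \<Longrightarrow> e \<in> parcs G \<Longrightarrow> continuous_on {0..len e} (u e)"
  using edge_problem.pair_cont[OF edge] admissibleD(1) by blast

lemma load_le:
  assumes u: "admissible u g"
  shows "load u \<le> (\<Sum>z\<in>pverts G. \<bar>\<omega> z\<bar>) * (\<Sum>e\<in>parcs G. sup_abs (len e) (u e))"
proof -
  note sup = sup_abs[OF len_pos edge_cont[OF u]]
  have nn: "0 \<le> (\<Sum>e\<in>parcs G. sup_abs (len e) (u e))" using sup(3) by (intro sum_nonneg)
  have "\<bar>trace u z\<bar> \<le> (\<Sum>e\<in>parcs G. sup_abs (len e) (u e))" for z
  proof (cases "incident_edges G z = {}")
    case False
    define e where "e = (SOME e. e \<in> incident_edges G z)"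
    have e: "e \<in> parcs G" unfolding e_def by (rule some_incident_edge[OF False])
    have "\<bar>trace u z\<bar> \<le> sup_abs (len e) (u e)"
      using False sup(2)[OF e e, of 0] sup(2)[OF e e, of "len e"] len_pos[OF e]
      by (auto simp: trace_def e_def[symmetric] end_value_def)
    also have "\<dots> \<le> (\<Sum>e\<in>parcs G. sup_abs (len e) (u e))"
      using e sup(3) by (intro member_le_sum) auto
    finally show ?thesis .
  qed (use nn in \<open>simp add: trace_def\<close>)
  then have "\<bar>\<omega> z\<bar> * \<bar>trace u z\<bar> \<le> \<bar>\<omega> z\<bar> * (\<Sum>e\<in>parcs G. sup_abs (len e) (u e))" for z
    by (intro mult_left_mono) auto
  then have "\<omega> z * trace u z \<le> \<bar>\<omega> z\<bar> * (\<Sum>e\<in>parcs G. sup_abs (len e) (u e))" for z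
    using abs_ge_self[of "\<omega> z * trace u z"] unfolding abs_mult by (rule order.trans[rotated])
  then show ?thesis unfolding load_def sum_distrib_right by (intro sum_mono)
qed

lemma energy_coercive:
  obtains C where "\<And>u g. admissible u g \<Longrightarrow>
    (\<Sum>e\<in>parcs G. sup_abs (len e) (u e)
      + (LINT x|lebesgue_on {0<..<len e}. \<bar>g e x\<bar> powr p e) / (2 * p e)) \<le> energy u g + C"
proof -
  \<comment> \<open>The load is at most W times the sum of the edge maxima, so slope
    \<open>W + 1\<close> on each edge absorbs it and leaves one copy of each maximum.\<close>
  define W where "W = (\<Sum>z\<in>pverts G. \<bar>\<omega> z\<bar>)"
  have W: "0 \<le> W" unfolding W_def by (intro sum_nonneg) auto
  have "\<forall>e\<in>parcs G. \<exists>C. \<forall>u g. sobolev_pair (p e) (len e) u g \<longrightarrow>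
      (W + 1) * sup_abs (len e) u + (LINT x|lebesgue_on {0<..<len e}. \<bar>g x\<bar> powr p e) / (2 * p e)
        \<le> edge_energy e u g + C"
  proof
    fix e assume e: "e \<in> parcs G"
    have "0 \<le> W + 1" using W by simp
    then show "\<exists>C. \<forall>u g. sobolev_pair (p e) (len e) u g \<longrightarrow>
      (W + 1) * sup_abs (len e) u + (LINT x|lebesgue_on {0<..<len e}. \<bar>g x\<bar> powr p e) / (2 * p e)
        \<le> edge_energy e u g + C"
    proof (rule edge_problem.energy_coercive[OF edge[OF e]])
      fix C assume *: "\<And>u g. sobolev_pair (p e) (len e) u g \<Longrightarrow>
        (W + 1) * sup_abs (len e) u + (LINT x|lebesgue_on {0<..<len e}. \<bar>g x\<bar> powr p e) / (2 * p e)
          \<le> edge_energy e u g + C"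
      show ?thesis by (intro exI[of _ C] allI impI *)
    qed
  qed
  from bchoice[OF this] obtain C where C: "\<And>e u g. e \<in> parcs G \<Longrightarrow> sobolev_pair (p e) (len e) u g \<Longrightarrow>
      (W + 1) * sup_abs (len e) u + (LINT x|lebesgue_on {0<..<len e}. \<bar>g x\<bar> powr p e) / (2 * p e)
        \<le> edge_energy e u g + C e" by blast
  show ?thesis
  proof
    fix u g assume u: "admissible u g"
    have "(\<Sum>e\<in>parcs G. (W + 1) * sup_abs (len e) (u e)
        + (LINT x|lebesgue_on {0<..<len e}. \<bar>g e x\<bar> powr p e) / (2 * p e))
      \<le> (\<Sum>e\<in>parcs G. edge_energy e (u e) (g e) + C e)"
      by (intro sum_mono C admissibleD(1)[OF u])
    then show "(\<Sum>e\<in>parcs G. sup_abs (len e) (u e)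
      + (LINT x|lebesgue_on {0<..<len e}. \<bar>g e x\<bar> powr p e) / (2 * p e)) \<le> energy u g + (\<Sum>e\<in>parcs G. C e)"
      using load_le[OF u]
      by (simp add: energy_def W_def[symmetric] sum.distrib distrib_right sum_distrib_left)
  qed
qed

lemma energy_midpoint:
  assumes u: "admissible u g" and w: "admissible w h"
  shows "energy (\<lambda>e x. (u e x + w e x) / 2) (\<lambda>e x. (g e x + h e x) / 2)
      + (\<Sum>e\<in>parcs G. LINT x|lebesgue_on {0<..<len e}. midpoint_gap (p e) (g e x) (h e x))
    \<le> (energy u g + energy w h) / 2"
proof -
  have load: "load (\<lambda>e x. (u e x + w e x) / 2) = (load u + load w) / 2"
    using load_lincomb[of "1/2" u "1/2" w] by (simp add: add_divide_distrib)
  have edges: "(\<Sum>e\<in>parcs G. edge_energy e (\<lambda>x. (u e x + w e x) / 2) (\<lambda>x. (g e x + h e x) / 2)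
      + (LINT x|lebesgue_on {0<..<len e}. midpoint_gap (p e) (g e x) (h e x)))
    \<le> (\<Sum>e\<in>parcs G. (edge_energy e (u e) (g e) + edge_energy e (w e) (h e)) / 2)"
    by (intro sum_mono edge_problem.energy_midpoint[OF edge] admissibleD(1)[OF u] admissibleD(1)[OF w])
  have "A - L + B \<le> (a - c + (b - d)) / 2" if "L = (c + d) / 2" "A + B \<le> (a + b) / 2" for A B L a b c d :: real
    using that by argo
  then show ?thesis
    using load edges[unfolded sum.distrib sum_divide_distrib[symmetric]] unfolding energy_def by blast
qed

text \<open>The passage to the limit takes place edge by edge through \<open>energy_limit\<close>,
  but along one subsequence common to all edges: only then do the matching conditions and the
  traces, which compare end values of different edges, survive in the limit.\<close>

lemma minimizer_exists:
  obtains w h where "admissible w h" "\<And>u g. admissible u g \<Longrightarrow> energy w h \<le> energy u g"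
proof -
  obtain C where C: "\<And>u g. admissible u g \<Longrightarrow>
    (\<Sum>e\<in>parcs G. sup_abs (len e) (u e)
      + (LINT x|lebesgue_on {0<..<len e}. \<bar>g e x\<bar> powr p e) / (2 * p e)) \<le> energy u g + C"
    by (rule energy_coercive) blast
  have p: "1 < p e" if "e \<in> parcs G" for e using edge_problem.p[OF edge[OF that]] .
  have terms: "0 \<le> sup_abs (len e) (u e)" "0 \<le> (LINT x|lebesgue_on {0<..<len e}. \<bar>g e x\<bar> powr p e) / (2 * p e)"
    if "admissible u g" "e \<in> parcs G" for u g e
    using sup_abs(3)[OF len_pos edge_cont[OF that(1)]] that(2) p[OF that(2)] by auto
  define S where "S = {energy u g |u g. admissible u g}"
  have "admissible (\<lambda>_ _. 0) (\<lambda>_ _. 0)"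
    by (auto simp: admissible_def matching_def end_value_def sobolev_pair_def Lp_on_def)
  then have S: "S \<noteq> {}" by (auto simp: S_def)
  have bdd: "bdd_below S"
  proof (rule bdd_belowI[of _ "- C"])
    fix s assume "s \<in> S"
    then obtain u g where u: "admissible u g" "s = energy u g" by (auto simp: S_def)
    have "0 \<le> (\<Sum>e\<in>parcs G. sup_abs (len e) (u e)
      + (LINT x|lebesgue_on {0<..<len e}. \<bar>g e x\<bar> powr p e) / (2 * p e))"
      using terms[OF u(1)] by (intro sum_nonneg add_nonneg_nonneg)
    then show "- C \<le> s" using C[OF u(1)] u(2) by linarith
  qed
  define m where "m = Inf S"
  have m: "m \<le> energy u g" if "admissible u g" for u g
    unfolding m_def using that bdd by (intro cInf_lower) (auto simp: S_def)
  have "\<exists>u g. admissible u g \<and> energy u g < m + 1 / (real n + 1)" for n :: nat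
  proof -
    have "Inf S < m + 1 / (real n + 1)" by (simp add: m_def)
    then obtain s where "s \<in> S" "s < m + 1 / (real n + 1)" using cInf_lessD[OF S] by blast
    then show ?thesis by (auto simp: S_def)
  qed
  then obtain U D where U: "\<And>n. admissible (U n) (D n)" "\<And>n. energy (U n) (D n) < m + 1 / (real n + 1)"
    by metis
  have U_le: "energy (U n) (D n) \<le> m + 1" for n
    using U(2)[of n] by (smt (verit) divide_le_eq_1_pos of_nat_0_le_iff)
  have parts: "sup_abs (len e) (U n e) \<le> m + 1 + C"
      "(LINT x|lebesgue_on {0<..<len e}. \<bar>D n e x\<bar> powr p e) \<le> 2 * p e * (m + 1 + C)"
    if e: "e \<in> parcs G" for n e
  proof -
    have "sup_abs (len e) (U n e) + (LINT x|lebesgue_on {0<..<len e}. \<bar>D n e x\<bar> powr p e) / (2 * p e)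
      \<le> (\<Sum>e\<in>parcs G. sup_abs (len e) (U n e)
        + (LINT x|lebesgue_on {0<..<len e}. \<bar>D n e x\<bar> powr p e) / (2 * p e))"
      using terms[OF U(1)] e by (intro member_le_sum add_nonneg_nonneg) auto
    then have *: "sup_abs (len e) (U n e) + (LINT x|lebesgue_on {0<..<len e}. \<bar>D n e x\<bar> powr p e) / (2 * p e)
      \<le> m + 1 + C"
      using C[OF U(1)[of n]] U_le[of n] by linarith
    show "sup_abs (len e) (U n e) \<le> m + 1 + C" using * terms[OF U(1) e, of n] by linarith
    have "(LINT x|lebesgue_on {0<..<len e}. \<bar>D n e x\<bar> powr p e) / (2 * p e) \<le> m + 1 + C"
      using * terms[OF U(1) e, of n] by linarith
    then show "(LINT x|lebesgue_on {0<..<len e}. \<bar>D n e x\<bar> powr p e) \<le> 2 * p e * (m + 1 + C)"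
      using p[OF e] by (simp add: pos_divide_le_eq mult.commute)
  qed
  have gap: "(LINT x|lebesgue_on {0<..<len e}. midpoint_gap (p e) (D n e x) (D k e x))
      \<le> (1 / (real n + 1) + 1 / (real k + 1)) / 2" if e: "e \<in> parcs G" for n k e
  proof -
    have "m \<le> energy (\<lambda>e x. (U n e x + U k e x) / 2) (\<lambda>e x. (D n e x + D k e x) / 2)"
      using admissible_lincomb[OF U(1)[of n] U(1)[of k], of "1/2" "1/2"] m by (simp add: add_divide_distrib)
    moreover note energy_midpoint[OF U(1)[of n] U(1)[of k]]
    moreover have "(LINT x|lebesgue_on {0<..<len e}. midpoint_gap (p e) (D n e x) (D k e x))
      \<le> (\<Sum>e\<in>parcs G. LINT x|lebesgue_on {0<..<len e}. midpoint_gap (p e) (D n e x) (D k e x))"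
      using e p midpoint_gap_nonneg by (intro member_le_sum integral_nonneg_AE AE_I2) auto
    ultimately show ?thesis using U(2)[of n] U(2)[of k] by argo
  qed
  have Cauchy: "\<exists>N. \<forall>n\<ge>N. \<forall>k\<ge>N. (LINT x|lebesgue_on {0<..<len e}. \<bar>D n e x - D k e x\<bar>) \<le> \<delta>"
    if e: "e \<in> parcs G" and \<delta>: "0 < \<delta>" for e \<delta>
  proof -
    \<comment> \<open>A bound, valid for all n and k, on the bracket multiplied by \<epsilon> in
      \<open>L1_dist_le_gap\<close>. With \<epsilon> = \<delta> / (2 B) this part contributes at
      most \<delta> / 2, and \<open>N\<close> below is chosen so that the gap part does too.\<close>
    define B where "B = len e + 2 * p e * (m + 1 + C) + 2 * p e * (m + 1 + C)"
    have "0 \<le> (LINT x|lebesgue_on {0<..<len e}. \<bar>D 0 e x\<bar> powr p e)" by (intro integral_nonneg_AE) auto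
    then have B: "0 < B" using parts(2)[OF e, of 0] len_pos[OF e] unfolding B_def by linarith
    have \<delta>B: "0 < \<delta> / (2 * B)" using \<delta> B by simp
    obtain K where K: "0 \<le> K" "\<And>u g w h. sobolev_pair (p e) (len e) u g \<Longrightarrow> sobolev_pair (p e) (len e) w h \<Longrightarrow>
      (LINT x|lebesgue_on {0<..<len e}. \<bar>g x - h x\<bar>) \<le> \<delta> / (2 * B) * (len e
        + (LINT x|lebesgue_on {0<..<len e}. \<bar>g x\<bar> powr p e) + (LINT x|lebesgue_on {0<..<len e}. \<bar>h x\<bar> powr p e))
      + K * (LINT x|lebesgue_on {0<..<len e}. midpoint_gap (p e) (g x) (h x))"
      by (rule edge_problem.L1_dist_le_gap[OF edge[OF e] \<delta>B]) blast
    obtain N :: nat where N: "K * 2 / \<delta> < real N" using reals_Archimedean2 by blast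
    show ?thesis
    proof (intro exI[of _ N] allI impI)
      fix n k assume nk: "N \<le> n" "N \<le> k"
      have "\<delta> / (2 * B) * (len e + (LINT x|lebesgue_on {0<..<len e}. \<bar>D n e x\<bar> powr p e)
          + (LINT x|lebesgue_on {0<..<len e}. \<bar>D k e x\<bar> powr p e)) \<le> \<delta> / (2 * B) * B"
        using parts(2)[OF e, of n] parts(2)[OF e, of k] \<delta> B by (intro mult_left_mono) (auto simp: B_def)
      also have "\<dots> = \<delta> / 2" using B by simp
      finally have 1: "\<delta> / (2 * B) * (len e + (LINT x|lebesgue_on {0<..<len e}. \<bar>D n e x\<bar> powr p e)
          + (LINT x|lebesgue_on {0<..<len e}. \<bar>D k e x\<bar> powr p e)) \<le> \<delta> / 2" .
      have "1 / (real n + 1) \<le> 1 / (real N + 1)" "1 / (real k + 1) \<le> 1 / (real N + 1)"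
        using nk by (auto intro!: divide_left_mono)
      then have "(1 / (real n + 1) + 1 / (real k + 1)) / 2 \<le> 1 / (real N + 1)" by simp
      then have "K * (LINT x|lebesgue_on {0<..<len e}. midpoint_gap (p e) (D n e x) (D k e x)) \<le> K * (1 / (real N + 1))"
        using gap[OF e, of n k] K(1) by (intro mult_left_mono) auto
      also have "\<dots> \<le> \<delta> / 2" using N \<delta> by (simp add: field_simps)
      finally show "(LINT x|lebesgue_on {0<..<len e}. \<bar>D n e x - D k e x\<bar>) \<le> \<delta>"
        using 1 K(2)[OF admissibleD(1)[OF U(1) e] admissibleD(1)[OF U(1) e], of n k] by linarith
    qed
  qed
  \<comment> \<open>Three extractions are composed: \<open>r0\<close> for the values at 0,
    \<open>r1\<close> for the p-energies and \<open>r2\<close> for the rate (1/2)^n.\<close>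
  obtain r0 where r0: "strict_mono r0" "\<And>e. e \<in> parcs G \<Longrightarrow> convergent (\<lambda>n. U (r0 n) e 0)"
  proof -
    have "bounded (range (\<lambda>n. U n e 0))" if e: "e \<in> parcs G" for e
      using sup_abs(2)[OF len_pos edge_cont[OF U(1)], OF e e, of 0] parts(1)[OF e] len_pos[OF e]
      by (intro boundedI[of _ "m + 1 + C"]) (fastforce intro: order.trans)
    then show ?thesis using finite_convergent_subsequence[of "parcs G" "\<lambda>e n. U n e 0"] that by auto
  qed
  obtain r1 where r1: "strict_mono r1" "\<And>e. e \<in> parcs G \<Longrightarrow>
      convergent (\<lambda>n. LINT x|lebesgue_on {0<..<len e}. \<bar>D (r0 (r1 n)) e x\<bar> powr p e)"
  proof -
    have "bounded (range (\<lambda>n. LINT x|lebesgue_on {0<..<len e}. \<bar>D (r0 n) e x\<bar> powr p e))" if e: "e \<in> parcs G" for e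
      using parts(2)[OF e] by (intro boundedI[of _ "2 * p e * (m + 1 + C)"]) auto
    then show ?thesis
      using finite_convergent_subsequence[of "parcs G" "\<lambda>e n. LINT x|lebesgue_on {0<..<len e}. \<bar>D (r0 n) e x\<bar> powr p e"]
        that by auto
  qed
  have "\<exists>N. \<forall>e\<in>parcs G. \<forall>i\<ge>N. \<forall>k\<ge>N. (LINT x|lebesgue_on {0<..<len e}. \<bar>D i e x - D k e x\<bar>) \<le> (1/2)^n" for n
  proof -
    have "\<forall>e\<in>parcs G. \<exists>N. \<forall>i\<ge>N. \<forall>k\<ge>N. (LINT x|lebesgue_on {0<..<len e}. \<bar>D i e x - D k e x\<bar>) \<le> (1/2)^n"
      by (intro ballI Cauchy) auto
    from bchoice[OF this] obtain N where N: "\<And>e i k. e \<in> parcs G \<Longrightarrow> N e \<le> i \<Longrightarrow> N e \<le> k \<Longrightarrow>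
      (LINT x|lebesgue_on {0<..<len e}. \<bar>D i e x - D k e x\<bar>) \<le> (1/2)^n"
      by blast
    have "N e \<le> (\<Sum>e\<in>parcs G. N e)" if "e \<in> parcs G" for e using that by (intro member_le_sum) auto
    then show ?thesis using N by (intro exI[of _ "\<Sum>e\<in>parcs G. N e"]) (meson order.trans)
  qed
  then obtain N where N: "\<And>n e i k. e \<in> parcs G \<Longrightarrow> N n \<le> i \<Longrightarrow> N n \<le> k \<Longrightarrow>
      (LINT x|lebesgue_on {0<..<len e}. \<bar>D i e x - D k e x\<bar>) \<le> (1/2)^n" by metis
  obtain r2 where r2: "strict_mono r2" "\<And>n. N n \<le> r2 n" using strict_mono_above by metis
  define r where "r = (\<lambda>n. r0 (r1 (r2 n)))"
  have r: "strict_mono r"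
    using r0(1) r1(1) r2(1) by (simp add: r_def strict_mono_def)
  \<comment> \<open>A strictly increasing sequence of indices satisfies n \<le> r n, so composing
    with \<open>r1\<close> and \<open>r0\<close> cannot fall below the threshold already met by
    \<open>r2\<close>.\<close>
  have r_ge: "N n \<le> r n" for n
    using r2(2)[of n] seq_suble[OF r1(1), of "r2 n"] seq_suble[OF r0(1), of "r1 (r2 n)"] by (simp add: r_def)
  define limits where "limits e w h c \<longleftrightarrow> sobolev_pair (p e) (len e) w h \<and>
      (\<forall>x\<in>{0..len e}. (\<lambda>n. U (r n) e x) \<longlonglongrightarrow> w x) \<and>
      (\<lambda>n. edge_energy e (U (r n) e) (D (r n) e)) \<longlonglongrightarrow> c \<and> edge_energy e w h \<le> c" for e w h c
  have "\<exists>w h c. limits e w h c" if e: "e \<in> parcs G" for e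
  proof -
    have c1: "convergent (\<lambda>n. U (r n) e 0)"
      using convergent_subseq_convergent[OF r0(2)[OF e] strict_mono_o[OF r1(1) r2(1)]] by (simp add: o_def r_def)
    have c2: "convergent (\<lambda>n. LINT x|lebesgue_on {0<..<len e}. \<bar>D (r n) e x\<bar> powr p e)"
      using convergent_subseq_convergent[OF r1(2)[OF e] r2(1)] by (simp add: o_def r_def)
    have fast: "(LINT x|lebesgue_on {0<..<len e}. \<bar>D (r (Suc n)) e x - D (r n) e x\<bar>) \<le> (1/2)^n" for n
    proof (rule N[OF e])
      show "N n \<le> r n" by (rule r_ge)
      then show "N n \<le> r (Suc n)" using strict_monoD[OF r, of n "Suc n"] by simp
    qed
    obtain c a where "(\<lambda>n. U (r n) e 0) \<longlonglongrightarrow> c"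
      "(\<lambda>n. LINT x|lebesgue_on {0<..<len e}. \<bar>D (r n) e x\<bar> powr p e) \<longlonglongrightarrow> a"
      using c1 c2 by (auto simp: convergent_def)
    from edge[OF e] admissibleD(1)[OF U(1) e] fast this parts(1)[OF e]
    show ?thesis
    proof (rule edge_problem.energy_limit)
      fix w h c assume "sobolev_pair (p e) (len e) w h" "\<And>x. x \<in> {0..len e} \<Longrightarrow> (\<lambda>n. U (r n) e x) \<longlonglongrightarrow> w x"
        "(\<lambda>n. edge_energy e (U (r n) e) (D (r n) e)) \<longlonglongrightarrow> c" "edge_energy e w h \<le> c"
      then have "limits e w h c" unfolding limits_def by blast
      then show ?thesis by blast
    qed
  qed
  then obtain w h c where *: "\<And>e. e \<in> parcs G \<Longrightarrow> limits e (w e) (h e) (c e)" by metis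
  have lim: "\<And>e. e \<in> parcs G \<Longrightarrow> sobolev_pair (p e) (len e) (w e) (h e)"
    "\<And>e x. e \<in> parcs G \<Longrightarrow> x \<in> {0..len e} \<Longrightarrow> (\<lambda>n. U (r n) e x) \<longlonglongrightarrow> w e x"
    "\<And>e. e \<in> parcs G \<Longrightarrow> (\<lambda>n. edge_energy e (U (r n) e) (D (r n) e)) \<longlonglongrightarrow> c e"
    "\<And>e. e \<in> parcs G \<Longrightarrow> edge_energy e (w e) (h e) \<le> c e"
    using * unfolding limits_def by blast+
  have end_lim: "(\<lambda>n. end_value len (U (r n)) e z) \<longlonglongrightarrow> end_value len w e z" if "e \<in> parcs G" for e z
    using lim(2)[OF that, of 0] lim(2)[OF that, of "len e"] len_pos[OF that] by (simp add: end_value_def)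
  have "matching w"
    unfolding matching_def
  proof (intro ballI)
    fix z e e' assume z: "z \<in> pverts G" and e: "e \<in> incident_edges G z" "e' \<in> incident_edges G z"
    then have E: "e \<in> parcs G" "e' \<in> parcs G" by (auto simp: incident_edges_def)
    have "end_value len (U (r n)) e z = end_value len (U (r n)) e' z" for n
      using admissibleD(2)[OF U(1)] z e unfolding matching_def by blast
    then show "end_value len w e z = end_value len w e' z"
      using LIMSEQ_unique[OF end_lim[OF E(1), of z]] end_lim[OF E(2), of z] by simp
  qed
  then have w: "admissible w h" using lim(1) by (simp add: admissible_def)
  have "(\<lambda>n. trace (U (r n)) z) \<longlonglongrightarrow> trace w z" for z
    using end_lim some_incident_edge[of z] by (cases "incident_edges G z = {}") (simp_all add: trace_def)
  then have "(\<lambda>n. load (U (r n))) \<longlonglongrightarrow> load w" unfolding load_def by (intro tendsto_intros)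
  then have "(\<lambda>n. energy (U (r n)) (D (r n))) \<longlonglongrightarrow> (\<Sum>e\<in>parcs G. c e) - load w"
    unfolding energy_def by (intro tendsto_intros lim(3))
  moreover have "(\<lambda>n. energy (U (r n)) (D (r n))) \<longlonglongrightarrow> m"
  proof -
    have "(\<lambda>n. energy (U n) (D n)) \<longlonglongrightarrow> m"
    proof (rule tendsto_sandwich)
      show "\<forall>\<^sub>F n in sequentially. m \<le> energy (U n) (D n)" using m U(1) by simp
      show "\<forall>\<^sub>F n in sequentially. energy (U n) (D n) \<le> m + 1 / (real n + 1)"
        using U(2) by (simp add: less_imp_le)
      show "(\<lambda>n. m + 1 / (real n + 1)) \<longlonglongrightarrow> m"
        using tendsto_add[OF tendsto_const[of m] LIMSEQ_inverse_real_of_nat]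
        by (simp add: inverse_eq_divide add.commute)
    qed simp
    then show ?thesis using LIMSEQ_subseq_LIMSEQ[OF _ r] by (simp add: o_def)
  qed
  \<comment> \<open>The energies converge to m along the minimizing sequence and also to the sum of
    the edge limits minus the limiting load. Each edge energy of w lies below its limit, so w
    attains the infimum.\<close>
  ultimately have "m = (\<Sum>e\<in>parcs G. c e) - load w" by (rule LIMSEQ_unique[symmetric])
  then have "energy w h \<le> m" unfolding energy_def using sum_mono[OF lim(4)] by simp
  then show ?thesis using that[OF w] m order.trans by blast
qed

text \<open>Only steps t > 0 are used: minimality and \<open>energy_slope\<close>, divided by t,
  bound the load by the slope at moved points, and t tending to 0 gives one inequality. Applying it
  to -\<phi> as well gives equality.\<close>

lemma minimizer_Euler_Lagrange:
  assumes w: "admissible w h" and min: "\<And>u g. admissible u g \<Longrightarrow> energy w h \<le> energy u g"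
    and \<phi>: "admissible \<phi> \<eta>"
  shows "(\<Sum>e\<in>parcs G. edge_slope e (w e) (h e) (\<phi> e) (\<eta> e)) = load \<phi>"
proof -
  have ge: "load \<phi> \<le> (\<Sum>e\<in>parcs G. edge_slope e (w e) (h e) (\<phi> e) (\<eta> e))"
    if \<phi>: "admissible \<phi> \<eta>" for \<phi> \<eta>
  proof -
    define t where "t = (\<lambda>n::nat. 1 / (real n + 1))"
    have t: "t \<longlonglongrightarrow> 0" "\<And>n. 0 < t n" "\<And>n. \<bar>t n\<bar> \<le> 1"
      using LIMSEQ_inverse_real_of_nat by (auto simp: t_def inverse_eq_divide add.commute)
    define s where "s = (\<lambda>n. \<Sum>e\<in>parcs G. edge_slope e (\<lambda>x. w e x + t n * \<phi> e x) (\<lambda>x. h e x + t n * \<eta> e x) (\<phi> e) (\<eta> e))"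
    have "load \<phi> \<le> s n" for n
    proof -
      have "(\<Sum>e\<in>parcs G. edge_energy e (\<lambda>x. w e x + t n * \<phi> e x) (\<lambda>x. h e x + t n * \<eta> e x)
          - edge_energy e (w e) (h e)) \<le> (\<Sum>e\<in>parcs G. t n * edge_slope e (\<lambda>x. w e x + t n * \<phi> e x) (\<lambda>x. h e x + t n * \<eta> e x) (\<phi> e) (\<eta> e))"
        by (intro sum_mono edge_problem.energy_slope[OF edge] admissibleD(1)[OF w] admissibleD(1)[OF \<phi>])
      moreover have "energy w h \<le> energy (\<lambda>e x. w e x + t n * \<phi> e x) (\<lambda>e x. h e x + t n * \<eta> e x)"
        using admissible_lincomb[OF w \<phi>, of 1 "t n"] min by simp
      moreover have "load (\<lambda>e x. w e x + t n * \<phi> e x) = load w + t n * load \<phi>"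
        using load_lincomb[of 1 w "t n" \<phi>] by simp
      ultimately have "t n * load \<phi> \<le> t n * s n"
        unfolding energy_def s_def sum_subtractf sum_distrib_left by linarith
      then show ?thesis using t(2)[of n] by simp
    qed
    moreover have "s \<longlonglongrightarrow> (\<Sum>e\<in>parcs G. edge_slope e (w e) (h e) (\<phi> e) (\<eta> e))"
      unfolding s_def
      by (intro tendsto_sum edge_problem.slope_tendsto[OF edge] admissibleD(1)[OF w] admissibleD(1)[OF \<phi>] t(1,3))
    ultimately show ?thesis by (intro LIMSEQ_le_const) auto
  qed
  have "admissible (\<lambda>e x. - \<phi> e x) (\<lambda>e x. - \<eta> e x)"
    using admissible_lincomb[OF \<phi> \<phi>, of "-1" 0] by simp
  moreover have "load (\<lambda>e x. - \<phi> e x) = - load \<phi>" using load_lincomb[of "-1" \<phi> 0 \<phi>] by simp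
  ultimately have "- load \<phi> \<le> (\<Sum>e\<in>parcs G. - edge_slope e (w e) (h e) (\<phi> e) (\<eta> e))"
    using ge[of "\<lambda>e x. - \<phi> e x" "\<lambda>e x. - \<eta> e x"] edge_problem.slope_minus[OF edge] by simp
  then show ?thesis using ge[OF \<phi>] by (simp add: sum_negf)
qed

end

section \<open>Weak solutions and minimizers\<close>

context network
begin

lemma admissible_imp_W1p_graph:
  assumes u: "admissible u g"
  shows "W1p_graph G len p u"
  using sobolev_pair_weak_deriv(1)[OF edge_problem.p[OF edge] len_pos admissibleD(1)[OF u]]
    edge_cont[OF u] admissibleD(2)[OF u]
  unfolding W1p_graph_def matching_def by blast

lemma W1p_graph_imp_admissible:
  assumes u: "W1p_graph G len p u"
  shows "admissible u (\<lambda>e. weak_deriv 0 (len e) (u e))"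
  using W1p_sobolev_pair[OF edge_problem.p[OF edge] len_pos] u
  unfolding W1p_graph_def matching_def admissible_def by blast

lemma vertex_value_eq_trace:
  assumes u: "matching u" and z: "z \<in> pverts G"
  shows "vertex_value G len u z = trace u z"
proof (cases "incident_edges G z = {}")
  case False
  define e where "e = (SOME e. e \<in> incident_edges G z)"
  have e: "e \<in> incident_edges G z" unfolding e_def by (rule some_incident[OF False])
  have "end_value len u e' z = end_value len u e z" if "e' \<in> incident_edges G z" for e'
    using u z e that unfolding matching_def by blast
  with e have "(\<forall>e'\<in>incident_edges G z. end_value len u e' z = c) \<longleftrightarrow> c = end_value len u e z" for c
    by metis
  then show ?thesis using False by (simp add: vertex_value_def trace_def e_def[symmetric])
qed (simp add: vertex_value_def trace_def)

text \<open>Replaces v by \<gamma>(u) inside the integral, where null sets do not count, and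
  collects the three integrals of each edge into its slope.\<close>

lemma weak_identity_iff:
  assumes u: "W1p_graph G len p u" and \<phi>: "W1p_graph G len p \<phi>"
    and v: "L1_graph G len v" "ae_eq_graph G len v (\<lambda>e x. \<gamma> e (u e x))"
  shows "graph_integral G len (\<lambda>e x. v e x * \<phi> e x) +
       (\<Sum>e\<in>parcs G. LINT x|lebesgue_on {0<..<len e}.
          \<bar>weak_deriv 0 (len e) (u e) x\<bar> powr (p e - 2) * weak_deriv 0 (len e) (u e) x *
          weak_deriv 0 (len e) (\<phi> e) x) =
       graph_integral G len (\<lambda>e x. f e x * \<phi> e x) + (\<Sum>z\<in>pverts G. \<omega> z * vertex_value G len \<phi> z)
    \<longleftrightarrow> (\<Sum>e\<in>parcs G. edge_slope e (u e) (weak_deriv 0 (len e) (u e)) (\<phi> e) (weak_deriv 0 (len e) (\<phi> e)))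
      = load \<phi>"
proof -
  note au = W1p_graph_imp_admissible[OF u] and a\<phi> = W1p_graph_imp_admissible[OF \<phi>]
  have "(LINT x|lebesgue_on {0<..<len e}. v e x * \<phi> e x) = (LINT x|lebesgue_on {0<..<len e}. \<gamma> e (u e x) * \<phi> e x)"
    if e: "e \<in> parcs G" for e
  proof (rule integral_cong_AE)
    show "(\<lambda>x. v e x * \<phi> e x) \<in> borel_measurable (lebesgue_on {0<..<len e})"
      using edge_problem.integrable_mult_cont[OF edge[OF e] _ edge_cont[OF a\<phi> e]] v(1) e
      unfolding L1_graph_def by blast
    show "(\<lambda>x. \<gamma> e (u e x) * \<phi> e x) \<in> borel_measurable (lebesgue_on {0<..<len e})"
      using edge_problem.integrable_mult_cont[OF edge[OF e] _ edge_cont[OF a\<phi> e]]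
        edge_problem.integrable_comp[OF edge[OF e] edge_problem.\<gamma>_cont[OF edge[OF e]] edge_cont[OF au e]]
      by blast
    have "AE x in lebesgue_on {0<..<len e}. v e x = \<gamma> e (u e x)" using v(2) e by (simp add: ae_eq_graph_def)
    then show "AE x in lebesgue_on {0<..<len e}. v e x * \<phi> e x = \<gamma> e (u e x) * \<phi> e x"
      by eventually_elim simp
  qed
  then have "graph_integral G len (\<lambda>e x. v e x * \<phi> e x)
      = (\<Sum>e\<in>parcs G. LINT x|lebesgue_on {0<..<len e}. \<gamma> e (u e x) * \<phi> e x)"
    by (simp add: graph_integral_def)
  moreover have "(\<Sum>z\<in>pverts G. \<omega> z * vertex_value G len \<phi> z) = load \<phi>"
    using vertex_value_eq_trace[OF admissibleD(2)[OF a\<phi>]] by (simp add: load_def)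
  moreover have "(\<Sum>e\<in>parcs G. edge_slope e (u e) (weak_deriv 0 (len e) (u e)) (\<phi> e) (weak_deriv 0 (len e) (\<phi> e)))
    = (\<Sum>e\<in>parcs G. (LINT x|lebesgue_on {0<..<len e}.
          \<bar>weak_deriv 0 (len e) (u e) x\<bar> powr (p e - 2) * weak_deriv 0 (len e) (u e) x *
          weak_deriv 0 (len e) (\<phi> e) x)
        + (LINT x|lebesgue_on {0<..<len e}. \<gamma> e (u e x) * \<phi> e x)
        - (LINT x|lebesgue_on {0<..<len e}. f e x * \<phi> e x))"
    by (intro sum.cong) (simp_all add: edge_problem.slope_def[OF edge] p_flux_def)
  ultimately show ?thesis
    by (simp add: graph_integral_def sum.distrib sum_subtractf) linarith
qed

lemma weak_solutionE:
  assumes "weak_solution G len p \<gamma> f \<omega> v"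
  obtains u where "W1p_graph G len p u" "ae_eq_graph G len v (\<lambda>e x. \<gamma> e (u e x))"
    "\<And>\<phi>. W1p_graph G len p \<phi> \<Longrightarrow>
      (\<Sum>e\<in>parcs G. edge_slope e (u e) (weak_deriv 0 (len e) (u e)) (\<phi> e) (weak_deriv 0 (len e) (\<phi> e)))
      = load \<phi>"
proof -
  obtain u where u: "L1_graph G len v" "W1p_graph G len p u" "ae_eq_graph G len v (\<lambda>e x. \<gamma> e (u e x))"
    and weak: "\<And>\<phi>. W1p_graph G len p \<phi> \<Longrightarrow>
      graph_integral G len (\<lambda>e x. v e x * \<phi> e x) +
       (\<Sum>e\<in>parcs G. LINT x|lebesgue_on {0<..<len e}.
          \<bar>weak_deriv 0 (len e) (u e) x\<bar> powr (p e - 2) * weak_deriv 0 (len e) (u e) x *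
          weak_deriv 0 (len e) (\<phi> e) x) =
       graph_integral G len (\<lambda>e x. f e x * \<phi> e x) + (\<Sum>z\<in>pverts G. \<omega> z * vertex_value G len \<phi> z)"
    using assms unfolding weak_solution_def by blast
  show ?thesis
    by (rule that[OF u(2,3)]) (rule iffD1[OF weak_identity_iff[OF u(2) _ u(1,3)] weak])
qed

lemma weak_solution_exists: "\<exists>v. weak_solution G len p \<gamma> f \<omega> v"
proof -
  obtain w h where w: "admissible w h" "\<And>u g. admissible u g \<Longrightarrow> energy w h \<le> energy u g"
    using minimizer_exists by metis
  note W = admissible_imp_W1p_graph[OF w(1)]
  note aw = W1p_graph_imp_admissible[OF W]
  define v where "v = (\<lambda>e x. \<gamma> e (w e x))"
  have v: "L1_graph G len v"
    unfolding L1_graph_def v_def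
    using edge_problem.integrable_comp[OF edge edge_problem.\<gamma>_cont[OF edge] edge_cont[OF w(1)]] by blast
  have ae: "ae_eq_graph G len v (\<lambda>e x. \<gamma> e (w e x))" by (simp add: ae_eq_graph_def v_def)
  have "(\<Sum>e\<in>parcs G. edge_slope e (w e) (weak_deriv 0 (len e) (w e)) (\<phi> e) (weak_deriv 0 (len e) (\<phi> e)))
      = load \<phi>" if \<phi>: "W1p_graph G len p \<phi>" for \<phi>
  proof -
    note a\<phi> = W1p_graph_imp_admissible[OF \<phi>]
    \<comment> \<open>The Euler-Lagrange identity holds for the derivative h found by minimization;
      \<open>slope_cong\<close> transfers it to the selected weak derivative.\<close>
    have "(\<Sum>e\<in>parcs G. edge_slope e (w e) (weak_deriv 0 (len e) (w e)) (\<phi> e) (weak_deriv 0 (len e) (\<phi> e)))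
      = (\<Sum>e\<in>parcs G. edge_slope e (w e) (h e) (\<phi> e) (weak_deriv 0 (len e) (\<phi> e)))"
      by (intro sum.cong edge_problem.slope_cong[OF edge] refl admissibleD(1)[OF aw]
          admissibleD(1)[OF w(1)] admissibleD(1)[OF a\<phi>])
    then show ?thesis using minimizer_Euler_Lagrange[OF w a\<phi>] by simp
  qed
  then show ?thesis
    unfolding weak_solution_def using v W ae weak_identity_iff[OF W _ v ae] by blast
qed

text \<open>Testing the difference of the two weak formulations with the difference of the potentials.\<close>

lemma weak_solution_unique:
  assumes v: "weak_solution G len p \<gamma> f \<omega> v" and w: "weak_solution G len p \<gamma> f \<omega> w"
  shows "ae_eq_graph G len w v"
proof -
  obtain a where a: "W1p_graph G len p a" "ae_eq_graph G len v (\<lambda>e x. \<gamma> e (a e x))"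
    and weak_a: "\<And>\<phi>. W1p_graph G len p \<phi> \<Longrightarrow>
      (\<Sum>e\<in>parcs G. edge_slope e (a e) (weak_deriv 0 (len e) (a e)) (\<phi> e) (weak_deriv 0 (len e) (\<phi> e))) = load \<phi>"
    by (rule weak_solutionE[OF v]) blast
  obtain b where b: "W1p_graph G len p b" "ae_eq_graph G len w (\<lambda>e x. \<gamma> e (b e x))"
    and weak_b: "\<And>\<phi>. W1p_graph G len p \<phi> \<Longrightarrow>
      (\<Sum>e\<in>parcs G. edge_slope e (b e) (weak_deriv 0 (len e) (b e)) (\<phi> e) (weak_deriv 0 (len e) (\<phi> e))) = load \<phi>"
    by (rule weak_solutionE[OF w]) blast
  define A B where "A = (\<lambda>e. weak_deriv 0 (len e) (a e))" and "B = (\<lambda>e. weak_deriv 0 (len e) (b e))"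
  have aa: "admissible a A" and ab: "admissible b B"
    unfolding A_def B_def using W1p_graph_imp_admissible a(1) b(1) by blast+
  define \<phi> where "\<phi> = (\<lambda>e x. a e x - b e x)"
  define \<eta> where "\<eta> = (\<lambda>e x. A e x - B e x)"
  have \<phi>: "admissible \<phi> \<eta>"
    using admissible_lincomb[OF aa ab, of 1 "-1"] by (simp add: \<phi>_def \<eta>_def)
  note W = admissible_imp_W1p_graph[OF \<phi>]
  \<comment> \<open>The weak formulation tests with the weak derivative selected for \<phi>, the
    monotonicity estimate with the difference \<eta> of the two selected derivatives. They agree
    almost everywhere only.\<close>
  have slope: "(\<Sum>e\<in>parcs G. edge_slope e (c e) (D e) (\<phi> e) (\<eta> e))
      = (\<Sum>e\<in>parcs G. edge_slope e (c e) (D e) (\<phi> e) (weak_deriv 0 (len e) (\<phi> e)))"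
    if "admissible c D" for c D
    by (intro sum.cong edge_problem.slope_cong[OF edge] refl admissibleD(1)[OF that]
        admissibleD(1)[OF \<phi>] admissibleD(1)[OF W1p_graph_imp_admissible[OF W]])
  define k where "k = (\<lambda>e x. (\<gamma> e (a e x) - \<gamma> e (b e x)) * (a e x - b e x))"
  have k: "integrable (lebesgue_on {0<..<len e}) (k e)" "\<And>x. 0 \<le> k e x"
      "(LINT x|lebesgue_on {0<..<len e}. k e x)
        \<le> edge_slope e (a e) (A e) (\<phi> e) (\<eta> e) - edge_slope e (b e) (B e) (\<phi> e) (\<eta> e)"
    if e: "e \<in> parcs G" for e
    using edge_problem.slope_monotone[OF edge[OF e] admissibleD(1)[OF aa e] admissibleD(1)[OF ab e]]
    unfolding k_def \<phi>_def \<eta>_def by blast+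
  have "(\<Sum>e\<in>parcs G. LINT x|lebesgue_on {0<..<len e}. k e x)
      \<le> (\<Sum>e\<in>parcs G. edge_slope e (a e) (A e) (\<phi> e) (\<eta> e) - edge_slope e (b e) (B e) (\<phi> e) (\<eta> e))"
    by (intro sum_mono k(3))
  also have "\<dots> = 0"
    using weak_a[OF W] weak_b[OF W] slope[OF aa] slope[OF ab]
    by (simp add: sum_subtractf A_def B_def)
  finally have le: "(\<Sum>e\<in>parcs G. LINT x|lebesgue_on {0<..<len e}. k e x) \<le> 0" .
  have nonneg: "0 \<le> (LINT x|lebesgue_on {0<..<len e}. k e x)" if "e \<in> parcs G" for e
    using k(2)[OF that] by (intro integral_nonneg_AE) auto
  have "(\<Sum>e\<in>parcs G. LINT x|lebesgue_on {0<..<len e}. k e x) = 0"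
    using le sum_nonneg[OF nonneg, of "parcs G"] by (intro antisym) auto
  then have zero: "(LINT x|lebesgue_on {0<..<len e}. k e x) = 0" if "e \<in> parcs G" for e
    using sum_nonneg_eq_0_iff[of "parcs G" "\<lambda>e. LINT x|lebesgue_on {0<..<len e}. k e x"] nonneg that
    by simp
  show ?thesis
    unfolding ae_eq_graph_def
  proof
    fix e assume e: "e \<in> parcs G"
    have "AE x in lebesgue_on {0<..<len e}. k e x = 0"
      using integral_nonneg_eq_0_iff_AE[OF k(1)[OF e]] k(2)[OF e] zero[OF e] by simp
    moreover have "AE x in lebesgue_on {0<..<len e}. v e x = \<gamma> e (a e x)"
      "AE x in lebesgue_on {0<..<len e}. w e x = \<gamma> e (b e x)"
      using a(2) b(2) e by (simp_all add: ae_eq_graph_def)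
    \<comment> \<open>Whichever factor of the product \<open>k\<close> vanishes, \<gamma>(a) and
      \<gamma>(b) coincide at that point.\<close>
    ultimately show "AE x in lebesgue_on {0<..<len e}. w e x = v e x"
      by eventually_elim (auto simp: k_def)
  qed
qed

end

theorem theorem3p16:
  fixes G :: "'v pair_pre_digraph"
    and len p :: "'v \<times> 'v \<Rightarrow> real"
    and \<gamma> :: "'v \<times> 'v \<Rightarrow> real \<Rightarrow> real"
    and f :: "'v graph_fun"
    and \<omega> :: "'v \<Rightarrow> real"
  assumes "compact_metric_graph G len"
    and "connected_graph G"
    and "\<And>e. e \<in> parcs G \<Longrightarrow> 1 < p e"
    and "\<And>e. e \<in> parcs G \<Longrightarrow> continuous_on UNIV (\<gamma> e)"
    and "\<And>e. e \<in> parcs G \<Longrightarrow> strict_mono (\<gamma> e)"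
    and "\<And>e. e \<in> parcs G \<Longrightarrow> range (\<gamma> e) = UNIV"
    and "\<And>e. e \<in> parcs G \<Longrightarrow> \<gamma> e 0 = 0"
    and "L1_graph G len f"
  shows "\<exists>v. weak_solution G len p \<gamma> f \<omega> v \<and>
           (\<forall>w. weak_solution G len p \<gamma> f \<omega> w \<longrightarrow> ae_eq_graph G len w v)"
proof -
  define primitive where "primitive \<gamma> \<Gamma> \<longleftrightarrow> continuous_on UNIV \<Gamma> \<and>
      (\<forall>a b. \<Gamma> b - \<Gamma> a \<le> \<gamma> b * (b - a)) \<and> (\<forall>K. \<exists>C. \<forall>s. K * \<bar>s\<bar> \<le> \<Gamma> s + C)"
    for \<gamma> \<Gamma> :: "real \<Rightarrow> real"
  have "\<exists>\<Gamma>. primitive (\<gamma> e) \<Gamma>" if "e \<in> parcs G" for e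
    using assms(4-6)[OF that]
  proof (rule convex_primitive_exists)
    fix \<Gamma> assume "continuous_on UNIV \<Gamma>" "\<And>a b. \<Gamma> b - \<Gamma> a \<le> \<gamma> e b * (b - a)"
      "\<And>K. \<exists>C. \<forall>s. K * \<bar>s\<bar> \<le> \<Gamma> s + C"
    then show "\<exists>\<Gamma>. primitive (\<gamma> e) \<Gamma>" unfolding primitive_def by blast
  qed
  then obtain \<Gamma> where \<Gamma>: "\<And>e. e \<in> parcs G \<Longrightarrow> primitive (\<gamma> e) (\<Gamma> e)" by metis
  interpret compact_metric_graph G len by fact
  interpret network G len p \<gamma> \<Gamma> f \<omega>
  proof (intro network.intro network_axioms.intro)
    show "compact_metric_graph G len" by fact
    fix e assume e: "e \<in> parcs G"
    show "edge_problem (p e) (len e) (\<gamma> e) (\<Gamma> e) (f e)"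
      using assms(3-5)[OF e] assms(8) \<Gamma>[OF e] len_pos[OF e] e
      unfolding edge_problem_def primitive_def L1_graph_def by blast
  qed
  show ?thesis using weak_solution_exists weak_solution_unique by blast
qed

end
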